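(* Let $n\ge 1$, $0<p<1$, and let $V:\mathbb{R}^n\times[0,\infty)\to[0,\infty)$ be continuous. Suppose there are a continuous function $\Lambda:[0,\infty)\to[0,\infty)$ and constants $\vartheta>0$, $\sigma\in\mathbb{R}$ such that $$V(x,t)\le \vartheta\,\Lambda(t)\,(1+|x|^2)^{\sigma_+/2}\qquad\text{for all }x\in\mathbb{R}^n,\ t\ge 0 .$$ Let $a\ge \frac{\sigma_+}{1-p}$. Then for every $u_0\in BC_a$ with $u_0\ge 0$, the Cauchy problem $\partial_t u-\Delta\partial_t u=\Delta u+V(x,t)u^p$ in $\mathbb{R}^n\times(0,\infty)$, $u(\cdot,0)=u_0$, has a global mild solution $0\le u\in \mathcal{Z}_{\infty,a}$.
   Context: $\sigma_+=\max\{\sigma,0\}$. $\mathcal{B}=(I-\Delta)^{-1}$ is the Bessel potential operator on $\mathbb{R}^n$, $\mathcal{B}\varphi=B*\varphi$ with $B=\mathcal{F}^{-1}\big((1+|\xi|^2)^{-1}\big)$ (a positive kernel with $\int B=1$). The pseudoparabolic Green operator is $\mathcal{G}(t)\varphi=e^{-t}\sum_{k\ge0}\frac{t^k}{k!}\mathcal{B}^k\varphi$. For $a\in\mathbb{R}$, $BC_a$ is the space of continuous $\varphi$ on $\mathbb{R}^n$ with $|\varphi(x)|\le C|x|^a$ for $|x|$ large, normed by $\|\varphi\|_{R,a}=\sup_x (R^2+|x|^2)^{-a/2}|\varphi(x)|$ ($R>0$; all these norms are equivalent). For $0<T\le\infty$, $\mathcal{Z}_{T,a}=C([0,T);BC_a)$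 and $Q_T=\mathbb{R}^n\times[0,T)$. A (mild) solution on $Q_T$ is $0\le u\in\mathcal{Z}_{T,a}$ with $u(t)=\mathcal{G}(t)u_0+\int_0^t\mathcal{G}(t-\tau)\mathcal{B}[V u^p](\tau)\,d\tau$ on $Q_T$; it is global if $T=\infty$. *)

theory Defs
  imports "HOL-Analysis.Analysis"
begin

definition pos_part :: "real \<Rightarrow> real" where
  "pos_part \<sigma> = max \<sigma> 0"

text \<open>Bessel kernel B = F^{-1}((1+|xi|^2)^{-1}) on R^n, n = CARD('n), written via the
  standard subordination formula B(x) = int_0^oo (4 pi s)^{-n/2} e^{-s} e^{-|x|^2/(4s)} ds,
  i.e. (I - Delta)^{-1} = int_0^oo e^{-s} e^{s Delta} ds.\<close>
definition bessel_kernel :: "real^'n \<Rightarrow> real" where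
  "bessel_kernel x =
     (LINT s:{0<..}|lborel. (4 * pi * s) powr (- real CARD('n) / 2) * exp (- s - (norm x)\<^sup>2 / (4 * s)))"

definition bessel_op :: "(real^'n \<Rightarrow> real) \<Rightarrow> (real^'n \<Rightarrow> real)" where
  "bessel_op \<phi> x = (LINT y|lborel. bessel_kernel (x - y) * \<phi> y)"

definition green_op :: "real \<Rightarrow> (real^'n \<Rightarrow> real) \<Rightarrow> (real^'n \<Rightarrow> real)" where
  "green_op t \<phi> x = exp (- t) * (\<Sum>k. t ^ k / fact k * (((bessel_op ^^ k) \<phi>) x))"

definition BC :: "real \<Rightarrow> (real^'n \<Rightarrow> real) set" where
  "BC a = {\<phi>. continuous_on UNIV \<phi> \<and>
              (\<exists>C R0. \<forall>x. norm x \<ge> R0 \<longrightarrow> \<bar>\<phi> x\<bar> \<le> C * norm x powr a)}"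

definition BC_norm :: "real \<Rightarrow> real \<Rightarrow> (real^'n \<Rightarrow> real) \<Rightarrow> real" where
  "BC_norm R a \<phi> = (SUP x. (R\<^sup>2 + (norm x)\<^sup>2) powr (- a / 2) * \<bar>\<phi> x\<bar>)"

definition Z_space :: "ereal \<Rightarrow> real \<Rightarrow> (real \<Rightarrow> real^'n \<Rightarrow> real) set" where
  "Z_space T a = {u. (\<forall>t. 0 \<le> t \<and> ereal t < T \<longrightarrow> u t \<in> BC a) \<and>
     (\<forall>t0. 0 \<le> t0 \<and> ereal t0 < T \<longrightarrow>
        ((\<lambda>t. BC_norm 1 a (\<lambda>x. u t x - u t0 x)) \<longlongrightarrow> 0) (at t0 within {t. 0 \<le> t \<and> ereal t < T}))}"

text \<open>Mild solution on Q_T of u_t - Delta u_t = Delta u + V u^p, u(0) = u0.\<close>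
definition mild_solution ::
  "(real^'n \<Rightarrow> real \<Rightarrow> real) \<Rightarrow> real \<Rightarrow> real \<Rightarrow> (real^'n \<Rightarrow> real) \<Rightarrow> ereal
     \<Rightarrow> (real \<Rightarrow> real^'n \<Rightarrow> real) \<Rightarrow> bool" where
  "mild_solution V p a u0 T u \<longleftrightarrow>
     u \<in> Z_space T a \<and>
     (\<forall>t x. 0 \<le> t \<and> ereal t < T \<longrightarrow> 0 \<le> u t x) \<and>
     (\<forall>t x. 0 \<le> t \<and> ereal t < T \<longrightarrow>
        u t x = green_op t u0 x +
          (LINT \<tau>:{0..t}|lborel.
             green_op (t - \<tau>) (bessel_op (\<lambda>y. V y \<tau> * (u \<tau> y) powr p)) x))"

end

theory Submission
  imports Defs "HOL-Probability.Distributions"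
begin

text \<open>
  Against the weight \<open>w(x) = (1 + |x|\<^sup>2)\<^bsup>a/2\<^esup>\<close> the Bessel kernel has finite moments, so
  \<open>|\<phi>| \<le> C w\<close> implies \<open>|\<B>\<phi>| \<le> K C w\<close> and \<open>|\<G>(t)\<phi>| \<le> e\<^bsup>K t\<^esup> C w\<close>. The condition
  \<open>a \<ge> \<sigma>\<^sub>+ / (1 - p)\<close> means exactly \<open>\<sigma>\<^sub>+ + a p \<le> a\<close>; together with \<open>h\<^sup>p \<le> h\<close> for
  \<open>h \<ge> 1\<close> it gives \<open>V (h w)\<^sup>p \<le> q h w\<close> on bounded time intervals, where \<open>q\<close> bounds \<open>\<theta>\<Lambda>\<close>.
  Hence \<open>M e\<^bsup>(K + K q) t\<^esup> w\<close> is a supersolution. No Lipschitz condition is available since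
  \<open>p < 1\<close>, but the Duhamel map is order preserving: its iterates starting from \<open>0\<close> increase and stay
  below the supersolution, and dominated convergence shows that their limit is a fixed point.
  The limit is a priori only measurable; the smoothing of \<open>\<B>\<close> makes it continuous in \<open>x\<close>, and the
  series for \<open>\<G>\<close> makes it locally Lipschitz in \<open>t\<close>.
\<close>

subsection \<open>The Bessel kernel\<close>

text \<open>This is \<open>exp (- s)\<close> times the heat kernel at time \<open>s\<close>. The
  indicator replaces a set integral by an integral over the whole line, so that Tonelli's theorem
  applies on a product of full spaces.\<close>

definition heat_integrand :: "real \<Rightarrow> real^'n \<Rightarrow> real" where
  "heat_integrand s x = indicator {0<..} s *
     ((4 * pi * s) powr (- real CARD('n) / 2) * exp (- s - (norm x)\<^sup>2 / (4 * s)))"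

text \<open>The reciprocal of the factor in \<open>BC_norm 1 a\<close>: a positive continuous
  stand-in for \<open>norm x powr a\<close>.\<close>

definition weight :: "real \<Rightarrow> real^'n \<Rightarrow> real" where
  "weight a x = (1 + (norm x)\<^sup>2) powr (a / 2)"

lemma bessel_kernel_eq: "bessel_kernel x = (LINT s|lborel. heat_integrand s x)"
  unfolding bessel_kernel_def heat_integrand_def set_lebesgue_integral_def by simp

lemma heat_integrand_nonneg: "0 \<le> heat_integrand s x"
  unfolding heat_integrand_def by (auto simp: indicator_def)

lemma bessel_kernel_nonneg: "0 \<le> bessel_kernel x"
  unfolding bessel_kernel_eq by (intro Bochner_Integration.integral_nonneg heat_integrand_nonneg)

lemma measurable_heat_integrand [measurable]:
  "(\<lambda>(s, x :: real^'n). heat_integrand s x) \<in> borel_measurable (borel \<Otimes>\<^sub>M borel)"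
  unfolding heat_integrand_def by measurable

lemma measurable_bessel_kernel [measurable]: "bessel_kernel \<in> borel_measurable borel"
proof -
  have "(\<lambda>x :: real^'n. LINT s|lborel. heat_integrand s x) \<in> borel_measurable borel"
    by measurable
  then show ?thesis by (simp add: bessel_kernel_eq[abs_def])
qed

section \<open>The polynomial weight and its growth\<close>

lemma weight_pos: "0 < weight a x"
proof -
  have "0 < 1 + (norm x)\<^sup>2" by (intro add_pos_nonneg) auto
  then show ?thesis unfolding weight_def by simp
qed

lemma weight_nonneg: "0 \<le> weight a x"
  using weight_pos[of a x] by simp

lemma continuous_on_weight: "continuous_on A (weight a :: real^'n \<Rightarrow> real)"
proof -
  have "1 + (norm x)\<^sup>2 \<noteq> 0" for x :: "real^'n"
    using add_pos_nonneg[of 1 "(norm x)\<^sup>2"] by simp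
  then show ?thesis unfolding weight_def by (intro continuous_intros) auto
qed

lemma measurable_weight [measurable]: "weight a \<in> borel_measurable borel"
  by (intro borel_measurable_continuous_onI continuous_on_weight)

text \<open>A Peetre-type inequality. It separates \<open>x\<close> from \<open>y\<close>, so that
  convolving the kernel with the weight reduces to a single moment of the kernel.\<close>

lemma weight_diff_le:
  assumes "0 \<le> a"
  shows "weight a (x - y) \<le> 2 powr (a / 2) * weight a x * weight a y"
proof -
  have "(norm (x - y))\<^sup>2 \<le> (norm x + norm y)\<^sup>2"
    by (intro power_mono norm_triangle_ineq4) simp
  also have "\<dots> \<le> 2 * (norm x)\<^sup>2 + 2 * (norm y)\<^sup>2"
    using zero_le_power2[of "norm x - norm y"] by (simp add: power2_eq_square algebra_simps)
  finally have "1 + (norm (x - y))\<^sup>2 \<le> 2 * (1 + (norm x)\<^sup>2) * (1 + (norm y)\<^sup>2)"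
    using mult_nonneg_nonneg[OF zero_le_power2[of "norm x"] zero_le_power2[of "norm y"]]
    unfolding distrib_left distrib_right by linarith
  then have "weight a (x - y) \<le> (2 * (1 + (norm x)\<^sup>2) * (1 + (norm y)\<^sup>2)) powr (a / 2)"
    unfolding weight_def using assms by (intro powr_mono2) auto
  then show ?thesis
    unfolding weight_def by (simp only: powr_mult)
qed

lemma powr_le_exp:
  fixes b d :: real
  assumes "0 \<le> b" "0 < d"
  obtains C where "0 < C" "\<And>v. 0 < v \<Longrightarrow> v powr b \<le> C * exp (d * v)"
proof
  \<comment> \<open>The bound \<open>ln y \<le> y - 1\<close> at \<open>y = v / c\<close> gives
    \<open>b * ln v\<close> slope \<open>b / c = b / (b + 1) * d\<close>, which is below
    \<open>d\<close>. Using \<open>b + 1\<close> keeps \<open>c\<close> positive also for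
    \<open>b = 0\<close>.\<close>
  define c where "c = (b + 1) / d"
  have c: "c > 0" using assms by (simp add: c_def)
  show "0 < exp (b * ln c)" by simp
  fix v :: real assume v: "0 < v"
  have "ln (v / c) \<le> v / c - 1" using v c by (intro ln_le_minus_one) simp
  then have "ln v \<le> v / c + ln c" using v c by (simp add: ln_div)
  then have "b * ln v \<le> b * (v / c + ln c)" using assms by (intro mult_left_mono)
  also have "\<dots> = b / (b + 1) * (d * v) + b * ln c"
    using assms by (simp add: c_def field_simps)
  also have "\<dots> \<le> 1 * (d * v) + b * ln c"
    using assms v by (intro add_right_mono mult_right_mono) auto
  finally have "exp (b * ln v) \<le> exp (d * v + b * ln c)" by simp
  then show "v powr b \<le> exp (b * ln c) * exp (d * v)"
    using v by (simp add: powr_def exp_add mult.commute)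
qed

text \<open>The rate 1/2 matches the factor \<open>exp (- norm x / 2)\<close> that
  \<open>heat_integrand_le\<close> extracts from the heat kernel.\<close>

lemma weight_le_exp:
  assumes "0 \<le> a"
  obtains C where "0 < C" "\<And>x :: real^'n. weight a x \<le> C * exp (norm x / 2)"
proof -
  obtain C where C: "0 < C" "\<And>v :: real. 0 < v \<Longrightarrow> v powr a \<le> C * exp (1/2 * v)"
    using powr_le_exp[of a "1/2"] assms by auto
  show ?thesis
  proof (rule that)
    show "0 < C * exp (1/2)" using C by simp
    fix x :: "real^'n"
    have "weight a x \<le> ((1 + norm x)\<^sup>2) powr (a / 2)"
      unfolding weight_def using assms
      by (intro powr_mono2) (auto simp: power2_eq_square algebra_simps)
    also have "\<dots> = (1 + norm x) powr a"
      by (simp add: powr_powr flip: powr_numeral)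
    also have "\<dots> \<le> C * exp (1/2 * (1 + norm x))"
      using C(2)[of "1 + norm x"] by (simp add: add_pos_nonneg)
    finally show "weight a x \<le> C * exp (1/2) * exp (norm x / 2)"
      by (simp add: exp_add[symmetric] add_divide_distrib mult.assoc)
  qed
qed

text \<open>A product of centred normal densities of variance \<open>4 * s\<close> is the heat
  kernel at time \<open>2 * s\<close>. The product form yields total mass 1 coordinate by
  coordinate.\<close>

lemma gaussian_product:
  fixes x :: "real^'n"
  assumes "0 < s"
  shows "(\<Prod>b\<in>Basis. normal_density 0 (2 * sqrt s) (x \<bullet> b))
    = (8 * pi * s) powr (- real CARD('n) / 2) * exp (- (norm x)\<^sup>2 / (8 * s))"
proof -
  have "(\<Prod>b\<in>Basis. normal_density 0 (2 * sqrt s) (x \<bullet> b))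
      = (\<Prod>b\<in>(Basis :: (real^'n) set). (8 * pi * s) powr (- 1/2) * exp (- (x \<bullet> b)\<^sup>2 / (8 * s)))"
    using assms
    by (intro prod.cong) (auto simp: normal_density_def power_mult_distrib mult_ac powr_minus_divide powr_half_sqrt)
  also have "\<dots> = ((8 * pi * s) powr (- 1/2)) ^ CARD('n) * exp (\<Sum>b\<in>Basis. - (x \<bullet> b)\<^sup>2 / (8 * s))"
    by (simp add: prod.distrib exp_sum)
  also have "(\<Sum>b\<in>Basis. - (x \<bullet> b)\<^sup>2 / (8 * s)) = - (norm x)\<^sup>2 / (8 * s)"
    unfolding power2_norm_eq_inner
    by (subst euclidean_inner) (simp add: sum_negf sum_divide_distrib power2_eq_square)
  also have "((8 * pi * s) powr (- 1/2)) ^ CARD('n) = (8 * pi * s) powr (- real CARD('n) / 2)"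
    using assms by (simp add: powr_powr flip: powr_realpow)
  finally show ?thesis .
qed

lemma nn_integral_gaussian_product:
  assumes "0 < s"
  shows "(\<integral>\<^sup>+ x. ennreal (\<Prod>b\<in>Basis. normal_density 0 (2 * sqrt s) (x \<bullet> b)) \<partial>(lborel :: (real^'n) measure)) = 1"
proof -
  have 1: "(\<integral>\<^sup>+ x. ennreal (normal_density 0 (2 * sqrt s) x) \<partial>lborel) = 1"
    using assms by (subst nn_integral_eq_integral) auto
  have "(\<integral>\<^sup>+ x. (\<Prod>b\<in>Basis. ennreal (normal_density 0 (2 * sqrt s) (x \<bullet> b))) \<partial>(lborel :: (real^'n) measure)) = 1"
    by (subst nn_integral_lborel_prod) (auto simp: 1)
  then show ?thesis by (simp add: prod_ennreal)
qed

text \<open>Half of \<open>exp (- s)\<close> and half of the Gaussian exponent are traded for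
  exponential decay in \<open>norm x\<close>. The other half of the exponent is a heat kernel at
  time \<open>2 * s\<close>, and the power of 2 compares the normalising constants.\<close>

lemma heat_integrand_le:
  fixes x :: "real^'n"
  assumes "0 < s"
  shows "heat_integrand s x \<le> 2 powr (real CARD('n) / 2) * exp (- s / 2) * exp (- norm x / 2)
    * (\<Prod>b\<in>Basis. normal_density 0 (2 * sqrt s) (x \<bullet> b))"
proof -
  have e: "- s - (norm x)\<^sup>2 / (4 * s) \<le> - s / 2 - norm x / 2 - (norm x)\<^sup>2 / (8 * s)"
  proof -
    \<comment> \<open>Completing the square is the arithmetic-geometric mean inequality between
      \<open>s / 2\<close> and the Gaussian exponent.\<close>
    have "0 \<le> (2 * s - norm x)\<^sup>2 / (8 * s)" using assms by simp
    also have "\<dots> = s / 2 - norm x / 2 + (norm x)\<^sup>2 / (8 * s)"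
      using assms by (simp add: power2_eq_square field_simps)
    finally have 1: "norm x / 2 \<le> s / 2 + (norm x)\<^sup>2 / (8 * s)" by simp
    have 2: "(norm x)\<^sup>2 / (4 * s) = (norm x)\<^sup>2 / (8 * s) + (norm x)\<^sup>2 / (8 * s)"
      using assms by (simp add: field_simps)
    show ?thesis unfolding 2 using 1 by simp
  qed
  have p: "(4 * pi * s) powr (- real CARD('n) / 2)
      = 2 powr (real CARD('n) / 2) * (8 * pi * s) powr (- real CARD('n) / 2)"
  proof -
    have "(8 * pi * s) powr (- real CARD('n) / 2) = (2 * (4 * pi * s)) powr (- real CARD('n) / 2)"
      by (simp add: mult.assoc)
    also have "\<dots> = 2 powr (- real CARD('n) / 2) * (4 * pi * s) powr (- real CARD('n) / 2)"
      by (rule powr_mult)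
    finally show ?thesis by (simp add: powr_minus field_simps)
  qed
  have "heat_integrand s x \<le> (4 * pi * s) powr (- real CARD('n) / 2)
      * exp (- s / 2 - norm x / 2 - (norm x)\<^sup>2 / (8 * s))"
    unfolding heat_integrand_def using assms e by (simp add: mult_left_mono)
  also have "exp (- s / 2 - norm x / 2 - (norm x)\<^sup>2 / (8 * s))
     = exp (- s / 2) * exp (- norm x / 2) * exp (- (norm x)\<^sup>2 / (8 * s))"
    by (simp flip: exp_add)
  finally show ?thesis
    unfolding gaussian_product[OF assms] p by (simp add: mult_ac)
qed

lemma nn_integral_exp_half:
  "(\<integral>\<^sup>+ s. ennreal (indicator {0<..} s * exp (- s / 2)) \<partial>lborel) \<le> ennreal 2"
proof -
  have "(\<integral>\<^sup>+ s. ennreal (indicator {0<..} s * exp (- s / 2)) \<partial>lborel)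
      \<le> (\<integral>\<^sup>+ s. ennreal (exp (- s / 2)) * indicator {0..} s \<partial>lborel)"
    by (intro nn_integral_mono) (auto simp: indicator_def)
  also have "\<dots> = ennreal (0 - (- 2 * exp (- 0 / 2)))"
  proof (rule nn_integral_FTC_atLeast)
    show "((\<lambda>s :: real. - 2 * exp (- s / 2)) \<longlongrightarrow> 0) at_top"
      by real_asymp
  qed (auto intro!: derivative_eq_intros)
  finally show ?thesis by simp
qed

text \<open>By Tonelli, \<open>x\<close> is integrated first: the growth of the weight cancels
  against \<open>exp (- norm x / 2)\<close>, the remaining Gaussian has mass 1, and only the
  integral of \<open>exp (- s / 2)\<close> is left.\<close>

lemma integrable_bessel_kernel_weight:
  assumes "0 \<le> a"
  shows "integrable lborel (\<lambda>x :: real^'n. bessel_kernel x * weight a x)"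
proof (rule integrableI_nonneg)
  obtain C where C: "0 < C" "\<And>x :: real^'n. weight a x \<le> C * exp (norm x / 2)"
    using weight_le_exp[OF assms] by metis
  let ?g = "\<lambda>s (x :: real^'n). (\<Prod>b\<in>Basis. normal_density 0 (2 * sqrt s) (x \<bullet> b))"
  define D where "D = C * 2 powr (real CARD('n) / 2)"
  have D: "0 \<le> D" using C by (simp add: D_def)
  have kernel_le: "ennreal (bessel_kernel x) \<le> (\<integral>\<^sup>+ s. ennreal (heat_integrand s x) \<partial>lborel)" for x :: "real^'n"
  proof (cases "integrable lborel (\<lambda>s. heat_integrand s x)")
    case True
    then show ?thesis
      unfolding bessel_kernel_eq by (subst nn_integral_eq_integral) (auto simp: heat_integrand_nonneg)
  next
    case False
    \<comment> \<open>for \<open>n \<ge> 2\<close> this happens at the origin, where the kernel takes the junk value \<open>0\<close>\<close>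
    then show ?thesis unfolding bessel_kernel_eq by (simp add: not_integrable_integral_eq)
  qed
  have pt: "heat_integrand s x * weight a x \<le> D * (indicator {0<..} s * exp (- s / 2)) * ?g s x"
    for s and x :: "real^'n"
  proof (cases "0 < s")
    case True
    have "heat_integrand s x * weight a x \<le>
       (2 powr (real CARD('n) / 2) * exp (- s / 2) * exp (- norm x / 2) * ?g s x) * (C * exp (norm x / 2))"
      using True C by (intro mult_mono heat_integrand_le)
        (auto simp: weight_nonneg intro!: mult_nonneg_nonneg prod_nonneg)
    also have "\<dots> = D * exp (- s / 2) * ?g s x * (exp (- norm x / 2) * exp (norm x / 2))"
      by (simp add: D_def)
    also have "exp (- norm x / 2) * exp (norm x / 2) = 1" by (simp flip: exp_add)
    finally show ?thesis using True by simp
  qed (simp add: heat_integrand_def)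
  have inner: "(\<integral>\<^sup>+ x. ennreal (heat_integrand s x * weight a x) \<partial>(lborel :: (real^'n) measure))
      \<le> ennreal D * ennreal (indicator {0<..} s * exp (- s / 2))" for s
  proof (cases "0 < s")
    case True
    have "(\<integral>\<^sup>+ x. ennreal (heat_integrand s x * weight a x) \<partial>(lborel :: (real^'n) measure))
      \<le> (\<integral>\<^sup>+ x. ennreal (D * (indicator {0<..} s * exp (- s / 2))) * ennreal (?g s x) \<partial>(lborel :: (real^'n) measure))"
      using pt D by (intro nn_integral_mono) (auto simp: prod_nonneg ennreal_leI simp flip: ennreal_mult'')
    also have "\<dots> = ennreal (D * (indicator {0<..} s * exp (- s / 2)))"
      using True by (subst nn_integral_cmult) (auto simp: nn_integral_gaussian_product)
    finally show ?thesis using D by (simp add: ennreal_mult)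
  qed (simp add: heat_integrand_def)
  have "(\<integral>\<^sup>+ x. ennreal (bessel_kernel x * weight a x) \<partial>(lborel :: (real^'n) measure))
     \<le> (\<integral>\<^sup>+ x. (\<integral>\<^sup>+ s. ennreal (heat_integrand s x) \<partial>lborel) * ennreal (weight a x) \<partial>(lborel :: (real^'n) measure))"
    using kernel_le by (intro nn_integral_mono) (auto simp: ennreal_mult bessel_kernel_nonneg weight_nonneg intro!: mult_right_mono)
  also have "\<dots> = (\<integral>\<^sup>+ x. (\<integral>\<^sup>+ s. ennreal (heat_integrand s x * weight a x) \<partial>lborel) \<partial>(lborel :: (real^'n) measure))"
    by (simp add: nn_integral_multc ennreal_mult heat_integrand_nonneg weight_nonneg)
  also have "\<dots> = (\<integral>\<^sup>+ s. (\<integral>\<^sup>+ x. ennreal (heat_integrand s x * weight a x) \<partial>(lborel :: (real^'n) measure)) \<partial>lborel)"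
    by (rule lborel_pair.Fubini') measurable
  also have "\<dots> \<le> (\<integral>\<^sup>+ s. ennreal D * ennreal (indicator {0<..} s * exp (- s / 2)) \<partial>lborel)"
    by (intro nn_integral_mono inner)
  also have "\<dots> = ennreal D * (\<integral>\<^sup>+ s. ennreal (indicator {0<..} s * exp (- s / 2)) \<partial>lborel)"
    by (rule nn_integral_cmult) measurable
  also have "\<dots> \<le> ennreal D * ennreal 2"
    by (intro mult_left_mono nn_integral_exp_half) simp
  also have "\<dots> < \<infinity>" by (simp add: ennreal_mult_less_top)
  finally show "(\<integral>\<^sup>+ x. ennreal (bessel_kernel x * weight a x) \<partial>(lborel :: (real^'n) measure)) < \<infinity>" .
qed (auto simp: bessel_kernel_nonneg weight_nonneg)

text \<open>Dominated convergence in \<open>s\<close>. Away from the origin the Gaussian factor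
  absorbs the singularity of the negative power of \<open>s\<close> at 0.\<close>

lemma bessel_kernel_tendsto:
  fixes X :: "nat \<Rightarrow> real^'n"
  assumes lim: "X \<longlonglongrightarrow> z" and z: "z \<noteq> 0"
  shows "(\<lambda>i. bessel_kernel (X i)) \<longlonglongrightarrow> bessel_kernel z"
proof -
  define r where "r = norm z / 2"
  have r: "0 < r" using z by (simp add: r_def)
  have "(\<lambda>i. norm (X i)) \<longlonglongrightarrow> norm z" by (intro tendsto_norm lim)
  moreover have "r < norm z" using z by (simp add: r_def)
  ultimately have "\<forall>\<^sub>F i in sequentially. r < norm (X i)" by (rule order_tendstoD)
  then obtain m where m: "\<And>i. i \<ge> m \<Longrightarrow> r < norm (X i)"
    by (auto simp: eventually_sequentially)
  \<comment> \<open>At \<open>v = 1 / (4 * pi * s)\<close> this rate gives exactly the exponent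
    \<open>r\<^sup>2 / (4 * s)\<close>, which the Gaussian factor then cancels.\<close>
  obtain C where C: "0 < C" "\<And>v :: real. 0 < v \<Longrightarrow> v powr (real CARD('n) / 2) \<le> C * exp (pi * r\<^sup>2 * v)"
    using powr_le_exp[of "real CARD('n) / 2" "pi * r\<^sup>2"] r by auto
  have bound: "heat_integrand s x \<le> C * (indicator {0<..} s * exp (- s / 2))" if "r < norm x" for s and x :: "real^'n"
  proof (cases "0 < s")
    case True
    have "r\<^sup>2 \<le> (norm x)\<^sup>2" using that r by (intro power_mono) auto
    then have e: "r\<^sup>2 / (4 * s) \<le> (norm x)\<^sup>2 / (4 * s)" using True by (intro divide_right_mono) auto
    have "heat_integrand s x = (1 / (4 * pi * s)) powr (real CARD('n) / 2) * exp (- s - (norm x)\<^sup>2 / (4 * s))"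
      using True by (simp add: heat_integrand_def powr_minus powr_divide field_simps)
    also have "\<dots> \<le> (C * exp (pi * r\<^sup>2 * (1 / (4 * pi * s)))) * exp (- s / 2 - r\<^sup>2 / (4 * s))"
      using True C e by (intro mult_mono C(2)) auto
    also have "\<dots> = C * (exp (r\<^sup>2 / (4 * s)) * exp (- s / 2 - r\<^sup>2 / (4 * s)))"
      using True by simp
    also have "\<dots> = C * exp (- s / 2)" by (simp flip: exp_add)
    finally show ?thesis using True by simp
  qed (simp add: heat_integrand_def)
  \<comment> \<open>The shift by \<open>m\<close> discards the initial terms, which may lie too
    close to the origin for the uniform bound.\<close>
  have "(\<lambda>i. bessel_kernel (X (i + m))) \<longlonglongrightarrow> bessel_kernel z"
    unfolding bessel_kernel_eq
  proof (rule integral_dominated_convergence)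
    have "(\<integral>\<^sup>+ s. ennreal (indicator {0<..} s * exp (- s / 2)) \<partial>lborel) < \<infinity>"
      using nn_integral_exp_half by (rule le_less_trans) simp
    then have "integrable lborel (\<lambda>s :: real. indicator {0<..} s * exp (- s / 2))"
      by (intro integrableI_nonneg) auto
    then show "integrable lborel (\<lambda>s :: real. C * (indicator {0<..} s * exp (- s / 2)))"
      by (rule integrable_mult_right)
    have "(\<lambda>i. heat_integrand s (X (i + m))) \<longlonglongrightarrow> heat_integrand s z" for s
      using LIMSEQ_ignore_initial_segment[OF lim, of m] unfolding heat_integrand_def
      by (cases "s > 0") (auto intro!: tendsto_intros)
    then show "AE s in lborel. (\<lambda>i. heat_integrand s (X (i + m))) \<longlonglongrightarrow> heat_integrand s z"
      by simp
  qed (use bound m in \<open>auto simp: heat_integrand_nonneg\<close>)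
  then show ?thesis by (rule LIMSEQ_offset)
qed

subsection \<open>The Bessel operator on weighted functions\<close>

lemma lborel_reflect: "distr lborel borel (\<lambda>y. x - y) = (lborel :: (real^'n) measure)"
  by (subst lborel_affine[of "-1" x]) (simp_all add: density_1)

lemma integrable_lborel_reflect:
  fixes f :: "real^'n \<Rightarrow> real"
  assumes "integrable lborel f"
  shows "integrable lborel (\<lambda>y. f (x - y))"
proof -
  have "integrable (distr lborel borel (\<lambda>y. x - y)) f" by (simp add: lborel_reflect assms)
  then show ?thesis by (subst (asm) integrable_distr_eq) (use assms in auto)
qed

lemma integral_lborel_reflect:
  fixes f :: "real^'n \<Rightarrow> real"
  assumes [measurable]: "f \<in> borel_measurable borel"
  shows "(\<integral> y. f (x - y) \<partial>lborel) = (\<integral> y. f y \<partial>lborel)"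
  by (subst (2) lborel_reflect[of x, symmetric]) (simp add: integral_distr)

text \<open>Measurability replaces the continuity demanded in \<open>BC\<close>, because a pointwise
  limit of the iterates is at first only measurable.\<close>

definition dominated :: "real \<Rightarrow> real \<Rightarrow> (real^'n \<Rightarrow> real) \<Rightarrow> bool" where
  "dominated a C \<phi> \<longleftrightarrow> \<phi> \<in> borel_measurable borel \<and> (\<forall>x. \<bar>\<phi> x\<bar> \<le> C * weight a x)"

lemma dominatedD:
  assumes "dominated a C \<phi>"
  shows "\<phi> \<in> borel_measurable borel" "\<bar>\<phi> x\<bar> \<le> C * weight a x"
  using assms by (auto simp: dominated_def)

lemma dominated_const_nonneg:
  assumes "dominated a C (\<phi> :: real^'n \<Rightarrow> real)"
  shows "0 \<le> C"
proof -
  have "0 \<le> C * weight a (0 :: real^'n)"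
    using dominatedD(2)[OF assms, of 0] by linarith
  then show ?thesis using weight_pos[of a "0 :: real^'n"] by (simp add: zero_le_mult_iff)
qed

lemma integrable_kernel_weight:
  assumes "0 \<le> a"
  shows "integrable lborel (\<lambda>y :: real^'n. bessel_kernel (x - y) * weight a y)"
proof -
  have *: "integrable lborel (\<lambda>z. bessel_kernel z * weight a (x - z))"
  proof (rule Bochner_Integration.integrable_bound)
    show "integrable lborel (\<lambda>z. (2 powr (a / 2) * weight a x) * (bessel_kernel z * weight a z))"
      by (intro integrable_mult_right integrable_bessel_kernel_weight assms)
    show "AE z in lborel. norm (bessel_kernel z * weight a (x - z))
        \<le> norm ((2 powr (a / 2) * weight a x) * (bessel_kernel z * weight a z))"
    proof (intro AE_I2)
      fix z :: "real^'n"
      have "bessel_kernel z * weight a (x - z) \<le> bessel_kernel z * (2 powr (a / 2) * weight a x * weight a z)"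
        by (intro mult_left_mono weight_diff_le bessel_kernel_nonneg assms)
      then show "norm (bessel_kernel z * weight a (x - z))
        \<le> norm ((2 powr (a / 2) * weight a x) * (bessel_kernel z * weight a z))"
        by (simp add: abs_mult abs_of_nonneg bessel_kernel_nonneg weight_nonneg mult_ac)
    qed
  qed measurable
  show ?thesis using integrable_lborel_reflect[OF *, of x] by simp
qed

lemma integrable_kernel_dominated:
  assumes "0 \<le> a" "dominated a C \<phi>"
  shows "integrable lborel (\<lambda>y :: real^'n. bessel_kernel (x - y) * \<phi> y)"
proof (rule Bochner_Integration.integrable_bound)
  note [measurable] = dominatedD(1)[OF assms(2)]
  show "integrable lborel (\<lambda>y. C * (bessel_kernel (x - y) * weight a y))"
    by (intro integrable_mult_right integrable_kernel_weight assms)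
  show "AE y in lborel. norm (bessel_kernel (x - y) * \<phi> y)
        \<le> norm (C * (bessel_kernel (x - y) * weight a y))"
  proof (intro AE_I2)
    fix y
    have "bessel_kernel (x - y) * \<bar>\<phi> y\<bar> \<le> bessel_kernel (x - y) * (C * weight a y)"
      by (intro mult_left_mono dominatedD assms bessel_kernel_nonneg)
    then show "norm (bessel_kernel (x - y) * \<phi> y) \<le> norm (C * (bessel_kernel (x - y) * weight a y))"
      using dominated_const_nonneg[OF assms(2)]
      by (simp add: abs_mult abs_of_nonneg bessel_kernel_nonneg weight_nonneg mult_ac)
  qed
  show "(\<lambda>y. bessel_kernel (x - y) * \<phi> y) \<in> borel_measurable lborel" by measurable
qed

text \<open>The constant \<open>K\<close> in the weighted bounds. The \<open>itself\<close> argument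
  carries the dimension, which the remaining types do not determine. The maximum with 1 makes
  positivity immediate.\<close>

definition bessel_const :: "'n::finite itself \<Rightarrow> real \<Rightarrow> real" where
  "bessel_const _ a = max 1 (2 powr (a / 2) * (LINT z :: real^'n|lborel. bessel_kernel z * weight a z))"

lemma bessel_const_ge_1: "1 \<le> bessel_const T a"
  by (simp add: bessel_const_def)

lemma bessel_op_weight_eq:
  "bessel_op (weight a) x = (LINT z :: real^'n|lborel. bessel_kernel z * weight a (x - z))"
proof -
  have [measurable]: "(\<lambda>z :: real^'n. bessel_kernel z * weight a (x - z)) \<in> borel_measurable borel"
    by measurable
  show ?thesis
    unfolding bessel_op_def
    by (subst integral_lborel_reflect[of "\<lambda>z. bessel_kernel z * weight a (x - z)" x, symmetric]) auto
qed

lemma bessel_op_weight_le: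
  assumes "0 \<le> a"
  shows "bessel_op (weight a) (x :: real^'n) \<le> bessel_const TYPE('n) a * weight a x"
proof -
  have "bessel_op (weight a) x \<le> (LINT z :: real^'n|lborel. (2 powr (a / 2) * weight a x) * (bessel_kernel z * weight a z))"
    unfolding bessel_op_weight_eq
  proof (rule integral_mono)
    show "integrable lborel (\<lambda>z. bessel_kernel z * weight a (x - z))"
      using integrable_lborel_reflect[OF integrable_kernel_weight[OF assms, of x], of x] by simp
    show "integrable lborel (\<lambda>z :: real^'n. (2 powr (a / 2) * weight a x) * (bessel_kernel z * weight a z))"
      by (intro integrable_mult_right integrable_bessel_kernel_weight assms)
    fix z
    show "bessel_kernel z * weight a (x - z) \<le> 2 powr (a / 2) * weight a x * (bessel_kernel z * weight a z)"
      using mult_left_mono[OF weight_diff_le[OF assms, of x z] bessel_kernel_nonneg[of z]]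
      by (simp add: mult_ac)
  qed
  also have "\<dots> = (2 powr (a / 2) * (LINT z :: real^'n|lborel. bessel_kernel z * weight a z)) * weight a x"
    by simp
  also have "\<dots> \<le> bessel_const TYPE('n) a * weight a x"
    unfolding bessel_const_def by (intro mult_right_mono weight_nonneg) simp
  finally show ?thesis .
qed

lemma bessel_op_mono:
  assumes "0 \<le> a" "dominated a C \<phi>" "dominated a D \<psi>" "\<And>y. \<phi> y \<le> \<psi> y"
  shows "bessel_op \<phi> x \<le> bessel_op \<psi> x"
  unfolding bessel_op_def
  by (intro integral_mono integrable_kernel_dominated[OF assms(1,2)] integrable_kernel_dominated[OF assms(1,3)]
      assms(4) mult_left_mono bessel_kernel_nonneg)

lemma bessel_op_abs_le:
  assumes "0 \<le> a" "dominated a C \<phi>"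
  shows "\<bar>bessel_op \<phi> (x :: real^'n)\<bar> \<le> bessel_const TYPE('n) a * C * weight a x"
proof -
  have C: "0 \<le> C" by (rule dominated_const_nonneg) fact
  have "\<bar>bessel_op \<phi> x\<bar> \<le> (LINT y|lborel. \<bar>bessel_kernel (x - y) * \<phi> y\<bar>)"
    unfolding bessel_op_def by (rule integral_abs_bound)
  also have "\<dots> \<le> (LINT y|lborel. C * (bessel_kernel (x - y) * weight a y))"
  proof (rule integral_mono)
    show "integrable lborel (\<lambda>y. \<bar>bessel_kernel (x - y) * \<phi> y\<bar>)"
      by (intro integrable_abs integrable_kernel_dominated[OF assms])
    show "integrable lborel (\<lambda>y. C * (bessel_kernel (x - y) * weight a y))"
      by (intro integrable_mult_right integrable_kernel_weight assms)
    fix y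
    show "\<bar>bessel_kernel (x - y) * \<phi> y\<bar> \<le> C * (bessel_kernel (x - y) * weight a y)"
      using mult_left_mono[OF dominatedD(2)[OF assms(2), of y] bessel_kernel_nonneg[of "x - y"]]
      by (simp add: abs_mult abs_of_nonneg bessel_kernel_nonneg mult_ac)
  qed
  also have "\<dots> = C * bessel_op (weight a) x"
    unfolding bessel_op_def by simp
  also have "\<dots> \<le> C * (bessel_const TYPE('n) a * weight a x)"
    by (intro mult_left_mono bessel_op_weight_le assms C)
  finally show ?thesis by (simp add: mult_ac)
qed

lemma measurable_bessel_op_param:
  fixes \<phi> :: "'b \<Rightarrow> real^'n \<Rightarrow> real"
  assumes [measurable]: "(\<lambda>(t, x). \<phi> t x) \<in> borel_measurable (M \<Otimes>\<^sub>M borel)"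
  shows "(\<lambda>(t, x). bessel_op (\<phi> t) x) \<in> borel_measurable (M \<Otimes>\<^sub>M borel)"
  unfolding bessel_op_def by measurable

lemma measurable_bessel_op [measurable]:
  assumes [measurable]: "\<phi> \<in> borel_measurable borel"
  shows "bessel_op \<phi> \<in> borel_measurable borel"
  unfolding bessel_op_def by measurable

lemma bessel_op_dominated:
  assumes "0 \<le> a" "dominated a C \<phi>"
  shows "dominated a (bessel_const TYPE('n) a * C) (bessel_op (\<phi> :: real^'n \<Rightarrow> real))"
  using bessel_op_abs_le[OF assms] dominatedD(1)[OF assms(2)] by (auto simp: dominated_def)

lemma bessel_op_tendsto:
  fixes \<phi> :: "nat \<Rightarrow> real^'n \<Rightarrow> real"
  assumes "0 \<le> a" "\<And>i. dominated a C (\<phi> i)" "dominated a D \<psi>" "\<And>y. (\<lambda>i. \<phi> i y) \<longlonglongrightarrow> \<psi> y"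
  shows "(\<lambda>i. bessel_op (\<phi> i) x) \<longlonglongrightarrow> bessel_op \<psi> x"
  unfolding bessel_op_def
proof (rule integral_dominated_convergence)
  note [measurable] = dominatedD(1)[OF assms(2)] dominatedD(1)[OF assms(3)]
  show "integrable lborel (\<lambda>y. C * (bessel_kernel (x - y) * weight a y))"
    by (intro integrable_mult_right integrable_kernel_weight assms)
  show "AE y in lborel. (\<lambda>i. bessel_kernel (x - y) * \<phi> i y) \<longlonglongrightarrow> bessel_kernel (x - y) * \<psi> y"
    by (intro AE_I2 tendsto_intros assms)
  show "AE y in lborel. norm (bessel_kernel (x - y) * \<phi> i y) \<le> C * (bessel_kernel (x - y) * weight a y)" for i
  proof (intro AE_I2)
    fix y
    show "norm (bessel_kernel (x - y) * \<phi> i y) \<le> C * (bessel_kernel (x - y) * weight a y)"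
      using mult_left_mono[OF dominatedD(2)[OF assms(2), of i y] bessel_kernel_nonneg[of "x - y"]]
      by (simp add: abs_mult abs_of_nonneg bessel_kernel_nonneg mult_ac)
  qed
  show "(\<lambda>y. bessel_kernel (x - y) * \<psi> y) \<in> borel_measurable lborel" by measurable
  show "(\<lambda>y. bessel_kernel (x - y) * \<phi> i y) \<in> borel_measurable lborel" for i by measurable
qed

text \<open>In the form \<open>bessel_op_weight_eq\<close> the translation acts on the continuous
  weight and not on the singular kernel, so dominated convergence applies: a convergent sequence is
  bounded, which makes \<open>weight_diff_le\<close> uniform in \<open>i\<close>.\<close>

lemma bessel_op_weight_tendsto:
  fixes X :: "nat \<Rightarrow> real^'n"
  assumes "0 \<le> a" "X \<longlonglongrightarrow> x"
  shows "(\<lambda>i. bessel_op (weight a) (X i)) \<longlonglongrightarrow> bessel_op (weight a) x"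
proof -
  have "bounded (range X)" using assms(2) by (intro convergent_imp_bounded)
  then obtain r where r: "\<And>i. norm (X i) \<le> r" by (auto simp: bounded_iff)
  define D where "D = 2 powr (a / 2) * (1 + r\<^sup>2) powr (a / 2)"
  have wX: "weight a (X i) \<le> (1 + r\<^sup>2) powr (a / 2)" for i
    unfolding weight_def using assms(1) r[of i] by (intro powr_mono2 add_mono power_mono) auto
  show ?thesis
    unfolding bessel_op_weight_eq
  proof (rule integral_dominated_convergence)
    show "integrable lborel (\<lambda>z :: real^'n. D * (bessel_kernel z * weight a z))"
      by (intro integrable_mult_right integrable_bessel_kernel_weight assms)
    have "(\<lambda>i. weight a (X i - z)) \<longlonglongrightarrow> weight a (x - z)" for z
      by (rule continuous_on_tendsto_compose[OF continuous_on_weight[of UNIV a]])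
         (use assms(2) in \<open>auto intro: tendsto_intros\<close>)
    then show "AE z in lborel. (\<lambda>i. bessel_kernel z * weight a (X i - z)) \<longlonglongrightarrow> bessel_kernel z * weight a (x - z)"
      by (intro AE_I2 tendsto_intros)
    show "AE z in lborel. norm (bessel_kernel z * weight a (X i - z)) \<le> D * (bessel_kernel z * weight a z)" for i
    proof (intro AE_I2)
      fix z
      have "weight a (X i - z) \<le> 2 powr (a / 2) * weight a (X i) * weight a z"
        by (rule weight_diff_le) fact
      also have "\<dots> \<le> D * weight a z"
        unfolding D_def by (intro mult_right_mono mult_left_mono wX weight_nonneg) auto
      finally have "bessel_kernel z * weight a (X i - z) \<le> bessel_kernel z * (D * weight a z)"
        by (intro mult_left_mono bessel_kernel_nonneg)
      then show "norm (bessel_kernel z * weight a (X i - z)) \<le> D * (bessel_kernel z * weight a z)"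
        by (simp add: abs_mult abs_of_nonneg bessel_kernel_nonneg weight_nonneg mult_ac)
    qed
  qed measurable
qed

text \<open>The kernel is continuous off the origin and the weighted masses of its translates converge,
  so Scheffe's lemma gives weighted \<open>L\<^sup>1\<close> convergence of the translates. Hence \<open>\<phi>\<close> need only be measurable.\<close>

lemma continuous_on_bessel_op:
  fixes \<phi> :: "real^'n \<Rightarrow> real"
  assumes a: "0 \<le> a" and \<phi>: "dominated a C \<phi>"
  shows "continuous_on A (bessel_op \<phi>)"
proof -
  have "(bessel_op \<phi> \<circ> X) \<longlonglongrightarrow> bessel_op \<phi> x" if X: "X \<longlonglongrightarrow> x" for X x
  proof -
    define F where "F = (\<lambda>x y :: real^'n. bessel_kernel (x - y) * weight a y)"
    have F_int: "integrable lborel (F x)" for x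
      unfolding F_def by (rule integrable_kernel_weight) fact
    have F_nn: "0 \<le> F x y" for x y
      by (simp add: F_def bessel_kernel_nonneg weight_nonneg)
    have F_nnint: "(\<integral>\<^sup>+ y. ennreal (norm (F x y)) \<partial>lborel) = ennreal (bessel_op (weight a) x)" for x
      using F_int[of x] F_nn unfolding bessel_op_def
      by (subst nn_integral_eq_integral) (auto simp: F_def abs_of_nonneg)
    have "(\<lambda>i. \<integral>\<^sup>+ y. ennreal (norm (F (X i) y - F x y)) \<partial>lborel) \<longlonglongrightarrow> 0"
    proof (rule Scheffe_lemma1)
      \<comment> \<open>The kernel may be singular where its argument vanishes, but this happens
        only at the null set \<open>y = x\<close>.\<close>
      have "AE y in lborel. y \<noteq> x" by (rule AE_lborel_singleton)
      then show "AE y in lborel. (\<lambda>i. F (X i) y) \<longlonglongrightarrow> F x y"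
        unfolding F_def
        by eventually_elim (intro tendsto_intros bessel_kernel_tendsto X, auto)
      have "(\<lambda>i. ennreal (bessel_op (weight a) (X i))) \<longlonglongrightarrow> ennreal (bessel_op (weight a) x)"
        by (intro tendsto_ennrealI bessel_op_weight_tendsto a X)
      then show "limsup (\<lambda>i. \<integral>\<^sup>+ y. ennreal (norm (F (X i) y)) \<partial>lborel) \<le> (\<integral>\<^sup>+ y. ennreal (norm (F x y)) \<partial>lborel)"
        unfolding F_nnint by (simp add: lim_imp_Limsup)
    qed (rule F_int)+
    moreover have "(\<integral>\<^sup>+ y. ennreal (norm (F (X i) y - F x y)) \<partial>lborel) = ennreal (LINT y|lborel. \<bar>F (X i) y - F x y\<bar>)" for i
      using F_int by (subst nn_integral_eq_integral) auto
    ultimately have "(\<lambda>i. ennreal (LINT y|lborel. \<bar>F (X i) y - F x y\<bar>)) \<longlonglongrightarrow> ennreal 0" by simp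
    then have "(\<lambda>i. LINT y|lborel. \<bar>F (X i) y - F x y\<bar>) \<longlonglongrightarrow> 0"
      by (subst (asm) tendsto_ennreal_iff) auto
    then have lim0: "(\<lambda>i. C * (LINT y|lborel. \<bar>F (X i) y - F x y\<bar>)) \<longlonglongrightarrow> 0"
      by (rule tendsto_mult_right_zero)
    have "\<bar>bessel_op \<phi> (X i) - bessel_op \<phi> x\<bar> \<le> C * (LINT y|lborel. \<bar>F (X i) y - F x y\<bar>)" for i
    proof -
      have "bessel_op \<phi> (X i) - bessel_op \<phi> x
          = (LINT y|lborel. bessel_kernel (X i - y) * \<phi> y - bessel_kernel (x - y) * \<phi> y)"
        unfolding bessel_op_def
        by (intro Bochner_Integration.integral_diff[symmetric] integrable_kernel_dominated[OF a \<phi>])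
      also have "\<bar>\<dots>\<bar> \<le> (LINT y|lborel. \<bar>bessel_kernel (X i - y) * \<phi> y - bessel_kernel (x - y) * \<phi> y\<bar>)"
        by (rule integral_abs_bound)
      also have "\<dots> \<le> (LINT y|lborel. C * \<bar>F (X i) y - F x y\<bar>)"
      proof (rule integral_mono)
        show "integrable lborel (\<lambda>y. \<bar>bessel_kernel (X i - y) * \<phi> y - bessel_kernel (x - y) * \<phi> y\<bar>)"
          by (intro integrable_abs Bochner_Integration.integrable_diff integrable_kernel_dominated[OF a \<phi>])
        show "integrable lborel (\<lambda>y. C * \<bar>F (X i) y - F x y\<bar>)"
          by (intro integrable_mult_right integrable_abs Bochner_Integration.integrable_diff F_int)
        fix y
        have "\<bar>bessel_kernel (X i - y) * \<phi> y - bessel_kernel (x - y) * \<phi> y\<bar>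
            = \<bar>bessel_kernel (X i - y) - bessel_kernel (x - y)\<bar> * \<bar>\<phi> y\<bar>"
          by (simp add: left_diff_distrib flip: abs_mult)
        also have "\<dots> \<le> \<bar>bessel_kernel (X i - y) - bessel_kernel (x - y)\<bar> * (C * weight a y)"
          by (intro mult_left_mono dominatedD(2)[OF \<phi>]) simp
        also have "\<dots> = C * \<bar>F (X i) y - F x y\<bar>"
          by (simp add: F_def abs_mult weight_nonneg flip: left_diff_distrib)
        finally show "\<bar>bessel_kernel (X i - y) * \<phi> y - bessel_kernel (x - y) * \<phi> y\<bar> \<le> C * \<bar>F (X i) y - F x y\<bar>" .
      qed
      also have "\<dots> = C * (LINT y|lborel. \<bar>F (X i) y - F x y\<bar>)" by simp
      finally show ?thesis .
    qed
    then have "(\<lambda>i. bessel_op \<phi> (X i) - bessel_op \<phi> x) \<longlonglongrightarrow> 0"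
      by (intro Lim_null_comparison[OF _ lim0]) auto
    then show ?thesis unfolding o_def by (rule LIM_zero_cancel)
  qed
  then have "continuous_on UNIV (bessel_op \<phi>)"
    by (simp add: continuous_on_sequentially)
  then show ?thesis by (rule continuous_on_subset) simp
qed

subsection \<open>The Green operator\<close>

lemma bessel_pow_dominated:
  assumes "0 \<le> a" "dominated a C \<phi>"
  shows "dominated a (bessel_const TYPE('n) a ^ k * C) ((bessel_op ^^ k) (\<phi> :: real^'n \<Rightarrow> real))"
proof (induction k)
  case (Suc k)
  show ?case using bessel_op_dominated[OF assms(1) Suc.IH] by (simp add: mult.assoc)
qed (simp add: assms)

lemma bessel_op_nonneg:
  assumes "\<And>y. 0 \<le> \<phi> y"
  shows "0 \<le> bessel_op \<phi> x"
  unfolding bessel_op_def using assms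
  by (intro Bochner_Integration.integral_nonneg mult_nonneg_nonneg bessel_kernel_nonneg)

lemma bessel_pow_nonneg:
  assumes "\<And>y. 0 \<le> \<phi> y"
  shows "0 \<le> (bessel_op ^^ k) \<phi> x"
  by (induction k arbitrary: x) (auto simp: assms intro: bessel_op_nonneg)

lemma bessel_pow_mono:
  assumes "0 \<le> a" "dominated a C \<phi>" "dominated a D \<psi>" "\<And>y. \<phi> y \<le> \<psi> y"
  shows "(bessel_op ^^ k) \<phi> (x :: real^'n) \<le> (bessel_op ^^ k) \<psi> x"
proof (induction k arbitrary: x)
  case (Suc k)
  show ?case
    using bessel_op_mono[OF assms(1) bessel_pow_dominated[OF assms(1,2)] bessel_pow_dominated[OF assms(1,3)] Suc.IH]
    by simp
qed (simp add: assms)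

lemma bessel_pow_tendsto:
  fixes \<phi> :: "nat \<Rightarrow> real^'n \<Rightarrow> real"
  assumes "0 \<le> a" "\<And>i. dominated a C (\<phi> i)" "dominated a D \<psi>" "\<And>y. (\<lambda>i. \<phi> i y) \<longlonglongrightarrow> \<psi> y"
  shows "(\<lambda>i. (bessel_op ^^ k) (\<phi> i) x) \<longlonglongrightarrow> (bessel_op ^^ k) \<psi> x"
proof (induction k arbitrary: x)
  case (Suc k)
  show ?case
    using bessel_op_tendsto[OF assms(1) bessel_pow_dominated[OF assms(1,2)] bessel_pow_dominated[OF assms(1,3)] Suc.IH]
    by simp
qed (simp add: assms)

text \<open>For \<open>k = 0\<close> the continuity is that of \<open>\<phi>\<close>; every later
  power is \<open>bessel_op\<close> of a dominated function and is continuous by smoothing.\<close>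

lemma continuous_on_bessel_pow:
  fixes \<phi> :: "real^'n \<Rightarrow> real"
  assumes "0 \<le> a" "dominated a C \<phi>" "continuous_on UNIV \<phi>"
  shows "continuous_on UNIV ((bessel_op ^^ k) \<phi>)"
proof (cases k)
  case (Suc j)
  then show ?thesis
    using continuous_on_bessel_op[OF assms(1) bessel_pow_dominated[OF assms(1,2), of j]] by simp
qed (simp add: assms)

lemma measurable_bessel_pow_param:
  fixes \<phi> :: "'b \<Rightarrow> real^'n \<Rightarrow> real"
  assumes "(\<lambda>(m, x). \<phi> m x) \<in> borel_measurable (M \<Otimes>\<^sub>M borel)"
  shows "(\<lambda>(m, x). (bessel_op ^^ k) (\<phi> m) x) \<in> borel_measurable (M \<Otimes>\<^sub>M borel)"
proof (induction k)
  case (Suc k)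
  show ?case using measurable_bessel_op_param[OF Suc.IH] by simp
qed (simp add: assms)

lemma exp_series_sums: "(\<lambda>k. (x :: real) ^ k / fact k) sums exp x"
  using exp_converges[of x] by (simp add: scaleR_conv_of_real divide_inverse mult.commute)

text \<open>Each application of \<open>bessel_op\<close> costs one factor \<open>K\<close>, so the
  Green series is majorised by the exponential series at \<open>K * t\<close>.\<close>

lemma green_term_le:
  fixes \<phi> :: "real^'n \<Rightarrow> real"
  assumes "0 \<le> a" "dominated a C \<phi>" "0 \<le> t"
  shows "\<bar>t ^ k / fact k * (bessel_op ^^ k) \<phi> x\<bar>
    \<le> (bessel_const TYPE('n) a * t) ^ k / fact k * (C * weight a x)"
proof -
  have "\<bar>t ^ k / fact k * (bessel_op ^^ k) \<phi> x\<bar> = t ^ k / fact k * \<bar>(bessel_op ^^ k) \<phi> x\<bar>"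
    using assms(3) by (simp add: abs_mult)
  also have "\<dots> \<le> t ^ k / fact k * (bessel_const TYPE('n) a ^ k * C * weight a x)"
    using assms(3) by (intro mult_left_mono dominatedD(2)[OF bessel_pow_dominated] assms) auto
  finally show ?thesis by (simp add: power_mult_distrib mult_ac)
qed

lemma summable_green_terms:
  fixes \<phi> :: "real^'n \<Rightarrow> real"
  assumes "0 \<le> a" "dominated a C \<phi>" "0 \<le> t"
  shows "summable (\<lambda>k. t ^ k / fact k * (bessel_op ^^ k) \<phi> x)"
proof (rule summable_comparison_test')
  show "summable (\<lambda>k. (bessel_const TYPE('n) a * t) ^ k / fact k * (C * weight a x))"
    using exp_series_sums by (intro summable_mult2) (auto simp: sums_iff)
qed (use green_term_le[OF assms] in auto)

lemma green_series_abs_le: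
  fixes \<phi> :: "real^'n \<Rightarrow> real"
  assumes "0 \<le> a" "dominated a C \<phi>" "0 \<le> t"
  shows "\<bar>\<Sum>k. t ^ k / fact k * (bessel_op ^^ k) \<phi> x\<bar> \<le> exp (bessel_const TYPE('n) a * t) * (C * weight a x)"
proof -
  have s: "(\<lambda>k. (bessel_const TYPE('n) a * t) ^ k / fact k * (C * weight a x))
      sums (exp (bessel_const TYPE('n) a * t) * (C * weight a x))"
    by (intro sums_mult2 exp_series_sums)
  show ?thesis
    using norm_suminf_le[OF _ sums_summable[OF s], of "\<lambda>k. t ^ k / fact k * (bessel_op ^^ k) \<phi> x"]
      green_term_le[OF assms] sums_unique[OF s] by simp
qed

lemma green_op_abs_le:
  fixes \<phi> :: "real^'n \<Rightarrow> real"
  assumes "0 \<le> a" "dominated a C \<phi>" "0 \<le> t"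
  shows "\<bar>green_op t \<phi> x\<bar> \<le> exp (bessel_const TYPE('n) a * t) * C * weight a x"
proof -
  have "\<bar>green_op t \<phi> x\<bar> = exp (- t) * \<bar>\<Sum>k. t ^ k / fact k * (bessel_op ^^ k) \<phi> x\<bar>"
    by (simp add: green_op_def abs_mult)
  \<comment> \<open>The damping factor \<open>exp (- t)\<close> is simply bounded by 1; the growth
    rate \<open>K\<close> is enough for a global bound.\<close>
  also have "\<dots> \<le> 1 * \<bar>\<Sum>k. t ^ k / fact k * (bessel_op ^^ k) \<phi> x\<bar>"
    using assms(3) by (intro mult_right_mono) auto
  also have "\<dots> \<le> exp (bessel_const TYPE('n) a * t) * (C * weight a x)"
    using green_series_abs_le[OF assms] by simp
  finally show ?thesis by simp
qed

lemma green_op_nonneg: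
  fixes \<phi> :: "real^'n \<Rightarrow> real"
  assumes "0 \<le> a" "dominated a C \<phi>" "0 \<le> t" "\<And>y. 0 \<le> \<phi> y"
  shows "0 \<le> green_op t \<phi> x"
  unfolding green_op_def using assms(3)
  by (intro mult_nonneg_nonneg suminf_nonneg summable_green_terms[OF assms(1-3)])
     (auto intro: mult_nonneg_nonneg bessel_pow_nonneg assms)

lemma green_op_mono:
  fixes \<phi> \<psi> :: "real^'n \<Rightarrow> real"
  assumes "0 \<le> a" "dominated a C \<phi>" "dominated a D \<psi>" "0 \<le> t" "\<And>y. \<phi> y \<le> \<psi> y"
  shows "green_op t \<phi> x \<le> green_op t \<psi> x"
  unfolding green_op_def using assms(4)
  by (intro mult_left_mono suminf_le summable_green_terms[OF assms(1,2)] summable_green_terms[OF assms(1,3)]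
      bessel_pow_mono[OF assms(1-3)] assms(5)) auto

text \<open>Tannery's theorem, that is, dominated convergence for series. The function and the
  evaluation point vary together, so one statement covers both convergence of functions at a fixed
  point and continuity in space.\<close>

lemma green_op_tendsto_gen:
  fixes \<phi> :: "nat \<Rightarrow> real^'n \<Rightarrow> real"
  assumes "0 \<le> a" "\<And>i. dominated a C (\<phi> i)" "0 \<le> t"
    and W: "\<And>i. weight a (X i) \<le> W"
    and lim: "\<And>k. (\<lambda>i. (bessel_op ^^ k) (\<phi> i) (X i)) \<longlonglongrightarrow> (bessel_op ^^ k) \<psi> x"
  shows "(\<lambda>i. green_op t (\<phi> i) (X i)) \<longlonglongrightarrow> green_op t \<psi> x"
proof -
  have C: "0 \<le> C" using dominated_const_nonneg[OF assms(2)] .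
  have "norm (t ^ k / fact k * (bessel_op ^^ k) (\<phi> i) (X i))
      \<le> (bessel_const TYPE('n) a * t) ^ k / fact k * (C * W)" for k i
  proof -
    have K: "0 \<le> bessel_const TYPE('n) a" using bessel_const_ge_1[of "TYPE('n)" a] by simp
    have "norm (t ^ k / fact k * (bessel_op ^^ k) (\<phi> i) (X i))
      \<le> (bessel_const TYPE('n) a * t) ^ k / fact k * (C * weight a (X i))"
      using green_term_le[OF assms(1-3)] by simp
    also have "\<dots> \<le> (bessel_const TYPE('n) a * t) ^ k / fact k * (C * W)"
      using assms(3) C K W by (intro mult_left_mono) auto
    finally show ?thesis .
  qed
  moreover have "summable (\<lambda>k. (bessel_const TYPE('n) a * t) ^ k / fact k * (C * W))"
    using exp_series_sums by (intro summable_mult2) (auto simp: sums_iff)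
  ultimately have "(\<lambda>i. \<Sum>k. t ^ k / fact k * (bessel_op ^^ k) (\<phi> i) (X i))
      \<longlonglongrightarrow> (\<Sum>k. t ^ k / fact k * (bessel_op ^^ k) \<psi> x)"
    by (intro tannerys_theorem[THEN conjunct2, THEN conjunct2] tendsto_intros lim)
       (auto intro: always_eventually)
  then show ?thesis unfolding green_op_def by (intro tendsto_intros)
qed

lemma green_op_tendsto:
  fixes \<phi> :: "nat \<Rightarrow> real^'n \<Rightarrow> real"
  assumes "0 \<le> a" "\<And>i. dominated a C (\<phi> i)" "dominated a D \<psi>" "0 \<le> t" "\<And>y. (\<lambda>i. \<phi> i y) \<longlonglongrightarrow> \<psi> y"
  shows "(\<lambda>i. green_op t (\<phi> i) x) \<longlonglongrightarrow> green_op t \<psi> x"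
  by (rule green_op_tendsto_gen[OF assms(1,2,4) order_refl bessel_pow_tendsto[OF assms(1-3,5)]])

lemma weight_convergent_bounded:
  fixes X :: "nat \<Rightarrow> real^'n"
  assumes "X \<longlonglongrightarrow> x"
  obtains W where "\<And>i. weight a (X i) \<le> W"
proof -
  have "(\<lambda>i. weight a (X i)) \<longlonglongrightarrow> weight a x"
    by (rule continuous_on_tendsto_compose[OF continuous_on_weight[of UNIV a]]) (use assms in auto)
  then have "bounded (range (\<lambda>i. weight a (X i)))" by (rule convergent_imp_bounded)
  then obtain W where "\<And>i. \<bar>weight a (X i)\<bar> \<le> W" by (auto simp: bounded_iff)
  then show ?thesis using that[of W] abs_ge_self order_trans by blast
qed

lemma continuous_on_green_op:
  fixes \<phi> :: "real^'n \<Rightarrow> real"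
  assumes "0 \<le> a" "dominated a C \<phi>" "0 \<le> t" "continuous_on UNIV \<phi>"
  shows "continuous_on UNIV (green_op t \<phi>)"
  unfolding continuous_on_sequentially o_def
proof (intro ballI allI impI, elim conjE)
  fix X x assume X: "X \<longlonglongrightarrow> (x :: real^'n)"
  obtain W where W: "\<And>i. weight a (X i) \<le> W" using weight_convergent_bounded[OF X] by blast
  have "(\<lambda>i. (bessel_op ^^ k) \<phi> (X i)) \<longlonglongrightarrow> (bessel_op ^^ k) \<phi> x" for k
    by (rule continuous_on_tendsto_compose[OF continuous_on_bessel_pow[OF assms(1,2,4)]]) (use X in auto)
  then show "(\<lambda>i. green_op t \<phi> (X i)) \<longlonglongrightarrow> green_op t \<phi> x"
    by (rule green_op_tendsto_gen[OF assms(1-3) W])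
qed

text \<open>The time is a function \<open>r\<close> of the parameter so that
  \<open>t - \<tau>\<close> and \<open>max 0 t\<close> can both be inserted.\<close>

lemma measurable_green_op_param:
  fixes \<phi> :: "'b \<Rightarrow> real^'n \<Rightarrow> real"
  assumes \<phi>: "(\<lambda>(m, x). \<phi> m x) \<in> borel_measurable (M \<Otimes>\<^sub>M borel)"
    and [measurable]: "r \<in> borel_measurable M"
  shows "(\<lambda>(m, x). green_op (r m) (\<phi> m) x) \<in> borel_measurable (M \<Otimes>\<^sub>M borel)"
proof -
  note [measurable] = measurable_bessel_pow_param[OF \<phi>]
  show ?thesis unfolding green_op_def by measurable
qed

lemma exp_diff_le:
  fixes K s t :: real
  assumes "s \<le> t" "0 \<le> K"
  shows "exp (K * t) - exp (K * s) \<le> K * (t - s) * exp (K * t)"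
proof -
  have "1 - exp (K * s - K * t) \<le> K * (t - s)"
    using exp_ge_add_one_self[of "K * s - K * t"] by (simp add: algebra_simps)
  then have "(1 - exp (K * s - K * t)) * exp (K * t) \<le> K * (t - s) * exp (K * t)"
    by (intro mult_right_mono) auto
  then show ?thesis by (simp add: left_diff_distrib flip: exp_add)
qed

text \<open>For nonnegative \<open>\<phi>\<close> the coefficients \<open>b k\<close> lie between 0
  and \<open>K ^ k * A\<close>, so increments of the series \<open>E\<close> are dominated by
  increments of \<open>exp (K * t) * A\<close>. The \<open>K\<close> in \<open>K + 1\<close> comes
  from the series, the 1 from the factor \<open>exp (- t)\<close>.\<close>

lemma green_op_lipschitz:
  fixes \<phi> :: "real^'n \<Rightarrow> real" and a :: real
  defines "K \<equiv> bessel_const TYPE('n) a"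
  assumes "0 \<le> a" "dominated a C \<phi>" "\<And>y. 0 \<le> \<phi> y" "0 \<le> s" "s \<le> t" "t \<le> T"
  shows "\<bar>green_op t \<phi> x - green_op s \<phi> x\<bar> \<le> (K + 1) * exp (K * T) * C * weight a x * (t - s)"
proof -
  define A where "A = C * weight a x"
  define b where "b = (\<lambda>k. (bessel_op ^^ k) \<phi> x)"
  define E where "E = (\<lambda>r. \<Sum>k. r ^ k / fact k * b k)"
  have K: "1 \<le> K" unfolding K_def by (rule bessel_const_ge_1)
  have C: "0 \<le> C" using dominated_const_nonneg[OF assms(3)] .
  have A: "0 \<le> A" by (simp add: A_def C weight_nonneg)
  have t: "0 \<le> t" using assms by simp
  have b: "0 \<le> b k" "b k \<le> K ^ k * A" for k
    using bessel_pow_nonneg[OF assms(4)] dominatedD(2)[OF bessel_pow_dominated[OF assms(2,3)], of k x]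
    by (auto simp: b_def A_def K_def mult.assoc)
  have sum: "summable (\<lambda>k. r ^ k / fact k * b k)" if "0 \<le> r" for r
    unfolding b_def using summable_green_terms[OF assms(2,3) that] .
  have expA: "(\<lambda>k. (K * r) ^ k / fact k * A) sums (exp (K * r) * A)" for r
    by (intro sums_mult2 exp_series_sums)
  have pw: "s ^ k \<le> t ^ k" for k using assms by (intro power_mono) auto
  have E_diff: "E t - E s = (\<Sum>k. t ^ k / fact k * b k - s ^ k / fact k * b k)"
    unfolding E_def by (rule suminf_diff[OF sum[OF t] sum[OF \<open>0 \<le> s\<close>]])
  have E_mono: "0 \<le> E t - E s"
    unfolding E_def diff_ge_0_iff_ge using pw b
    by (intro suminf_le sum t \<open>0 \<le> s\<close>) (auto intro!: mult_right_mono divide_right_mono)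
  have "E t - E s \<le> (exp (K * t) * A - exp (K * s) * A)"
    unfolding E_diff
  proof (rule sums_le[OF _ summable_sums sums_diff[OF expA expA]])
    show "summable (\<lambda>k. t ^ k / fact k * b k - s ^ k / fact k * b k)"
      by (intro summable_diff sum t assms)
    fix k
    have "(t ^ k - s ^ k) / fact k * b k \<le> (t ^ k - s ^ k) / fact k * (K ^ k * A)"
      using pw b by (intro mult_left_mono) auto
    then show "t ^ k / fact k * b k - s ^ k / fact k * b k \<le> (K * t) ^ k / fact k * A - (K * s) ^ k / fact k * A"
      by (simp add: power_mult_distrib field_simps)
  qed
  also have "\<dots> = (exp (K * t) - exp (K * s)) * A" by (simp add: left_diff_distrib)
  also have "\<dots> \<le> (K * (t - s) * exp (K * t)) * A"
    using exp_diff_le[of s t K] K assms A by (intro mult_right_mono) auto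
  also have "\<dots> \<le> (K * (t - s) * exp (K * T)) * A"
    using K assms A by (intro mult_right_mono mult_left_mono) auto
  finally have 1: "E t - E s \<le> K * (t - s) * exp (K * T) * A" .
  have "E s \<le> exp (K * s) * A"
    using green_series_abs_le[OF assms(2,3,5), of x] by (simp add: E_def b_def K_def A_def)
  also have "\<dots> \<le> exp (K * T) * A"
    using K assms A by (intro mult_right_mono) auto
  finally have 2: "E s \<le> exp (K * T) * A" .
  have E0: "0 \<le> E s" unfolding E_def using b assms(5) by (intro suminf_nonneg sum) auto
  have d0: "0 \<le> exp (- s) - exp (- t)" using assms by simp
  have d1: "exp (- s) - exp (- t) \<le> t - s"
  proof -
    have "exp (1 * - s) - exp (1 * - t) \<le> 1 * (- s - - t) * exp (1 * - s)"
      using assms by (intro exp_diff_le) auto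
    also have "\<dots> \<le> 1 * (- s - - t) * 1" using assms by (intro mult_left_mono) auto
    finally show ?thesis by simp
  qed
  have "green_op t \<phi> x - green_op s \<phi> x = exp (- t) * (E t - E s) - (exp (- s) - exp (- t)) * E s"
    by (simp add: green_op_def E_def b_def algebra_simps)
  also have "\<bar>\<dots>\<bar> \<le> exp (- t) * (E t - E s) + (exp (- s) - exp (- t)) * E s"
  proof -
    have "0 \<le> exp (- t) * (E t - E s)" using E_mono by simp
    moreover have "0 \<le> (exp (- s) - exp (- t)) * E s" using d0 E0 by (rule mult_nonneg_nonneg)
    ultimately show ?thesis by linarith
  qed
  also have "\<dots> \<le> 1 * (K * (t - s) * exp (K * T) * A) + (t - s) * (exp (K * T) * A)"
    using 1 2 d0 d1 E0 E_mono t assms by (intro add_mono mult_mono) auto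
  finally show ?thesis by (simp add: A_def algebra_simps)
qed

subsection \<open>The Duhamel term\<close>

text \<open>The bounds concern \<open>{0..T}\<close> only, while measurability is global because the
  parameter integrals run over the whole line.\<close>

definition forcing :: "real \<Rightarrow> real \<Rightarrow> real \<Rightarrow> (real \<Rightarrow> real^'n \<Rightarrow> real) \<Rightarrow> bool" where
  "forcing a C T F \<longleftrightarrow> (\<lambda>(\<tau>, y). F \<tau> y) \<in> borel_measurable (borel \<Otimes>\<^sub>M borel) \<and>
     (\<forall>\<tau>\<in>{0..T}. \<forall>y. 0 \<le> F \<tau> y \<and> F \<tau> y \<le> C * weight a y)"

text \<open>The indicator moves the \<open>t\<close>-dependence of the domain into the integrand, so
  that different times can be compared under one integral.\<close>

definition duhamel_integrand :: "(real \<Rightarrow> real^'n \<Rightarrow> real) \<Rightarrow> real \<Rightarrow> real^'n \<Rightarrow> real \<Rightarrow> real" where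
  "duhamel_integrand F t x \<tau> = indicator {0..t} \<tau> * green_op (t - \<tau>) (bessel_op (F \<tau>)) x"

definition duhamel :: "(real \<Rightarrow> real^'n \<Rightarrow> real) \<Rightarrow> real \<Rightarrow> real^'n \<Rightarrow> real" where
  "duhamel F t x = (LINT \<tau>|lborel. duhamel_integrand F t x \<tau>)"

lemma duhamel_set_integral:
  "duhamel F t x = (LINT \<tau>:{0..t}|lborel. green_op (t - \<tau>) (bessel_op (F \<tau>)) x)"
  unfolding duhamel_def duhamel_integrand_def set_lebesgue_integral_def by simp

lemma forcing_dominated:
  assumes "forcing a C T F" "0 \<le> \<tau>" "\<tau> \<le> T" "\<And>y. F \<tau> y \<le> D * weight a y"
  shows "dominated a D (F \<tau>)"
proof -
  have [measurable]: "(\<lambda>(\<tau>, y). F \<tau> y) \<in> borel_measurable (borel \<Otimes>\<^sub>M borel)"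
    using assms(1) by (simp add: forcing_def)
  have "F \<tau> \<in> borel_measurable borel" by measurable
  then show ?thesis using assms by (auto simp: dominated_def forcing_def)
qed

lemma forcingD:
  assumes "forcing a C T F" "0 \<le> \<tau>" "\<tau> \<le> T"
  shows "dominated a C (F \<tau>)" "0 \<le> F \<tau> y"
  using forcing_dominated[OF assms] assms by (auto simp: forcing_def)

text \<open>Pulls the parametrised measurability of \<open>bessel_op\<close> and
  \<open>green_op\<close> back along coordinate maps. Joint measurability in
  \<open>((t, x), \<tau>)\<close> is what makes \<open>duhamel F\<close> measurable in
  \<open>(t, x)\<close>.\<close>

lemma measurable_duhamel_integrand:
  fixes F :: "real \<Rightarrow> real^'n \<Rightarrow> real"
  assumes F: "(\<lambda>(\<tau>, y). F \<tau> y) \<in> borel_measurable (borel \<Otimes>\<^sub>M borel)"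
  shows "(\<lambda>p. duhamel_integrand F (fst (fst p)) (snd (fst p)) (snd p))
    \<in> borel_measurable ((borel \<Otimes>\<^sub>M borel) \<Otimes>\<^sub>M borel)"
proof -
  have "(\<lambda>q :: (real \<times> real) \<times> (real^'n). (snd (fst q), snd q))
      \<in> (borel \<Otimes>\<^sub>M borel) \<Otimes>\<^sub>M borel \<rightarrow>\<^sub>M borel \<Otimes>\<^sub>M borel"
    by measurable
  from measurable_compose[OF this measurable_bessel_op_param[OF F]]
  have 1: "(\<lambda>(m :: real \<times> real, x). bessel_op (F (snd m)) x) \<in> borel_measurable ((borel \<Otimes>\<^sub>M borel) \<Otimes>\<^sub>M borel)"
    by (simp add: split_beta')
  have 2: "(\<lambda>m :: real \<times> real. fst m - snd m) \<in> borel_measurable (borel \<Otimes>\<^sub>M borel)"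
    by measurable
  have "(\<lambda>p :: (real \<times> (real^'n)) \<times> real. ((fst (fst p), snd p), snd (fst p)))
      \<in> (borel \<Otimes>\<^sub>M borel) \<Otimes>\<^sub>M borel \<rightarrow>\<^sub>M (borel \<Otimes>\<^sub>M borel) \<Otimes>\<^sub>M borel"
    by measurable
  from measurable_compose[OF this measurable_green_op_param[OF 1 2]]
  have "(\<lambda>p. green_op (fst (fst p) - snd p) (bessel_op (F (snd p))) (snd (fst p)))
     \<in> borel_measurable ((borel \<Otimes>\<^sub>M borel) \<Otimes>\<^sub>M borel)"
    by simp
  moreover have "(\<lambda>p :: (real \<times> (real^'n)) \<times> real. of_bool (0 \<le> snd p \<and> snd p \<le> fst (fst p)) :: real)
     \<in> borel_measurable ((borel \<Otimes>\<^sub>M borel) \<Otimes>\<^sub>M borel)"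
    by measurable
  ultimately have "(\<lambda>p. of_bool (0 \<le> snd p \<and> snd p \<le> fst (fst p))
      * green_op (fst (fst p) - snd p) (bessel_op (F (snd p))) (snd (fst p)))
     \<in> borel_measurable ((borel \<Otimes>\<^sub>M borel) \<Otimes>\<^sub>M borel)"
    by (rule borel_measurable_times[rotated])
  then show ?thesis
    by (simp add: duhamel_integrand_def indicator_def)
qed

lemma measurable_duhamel_integrand_section:
  assumes "(\<lambda>(\<tau>, y). F \<tau> y) \<in> borel_measurable (borel \<Otimes>\<^sub>M borel)"
  shows "duhamel_integrand F t x \<in> borel_measurable borel"
  using measurable_compose[OF measurable_Pair1' measurable_duhamel_integrand[OF assms], of "(t, x)"]
  by (simp add: space_pair_measure)

lemma measurable_duhamel:
  assumes "(\<lambda>(\<tau>, y). F \<tau> y) \<in> borel_measurable (borel \<Otimes>\<^sub>M borel)"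
  shows "(\<lambda>(t, x). duhamel F t x) \<in> borel_measurable (borel \<Otimes>\<^sub>M borel)"
proof -
  have "case_prod (\<lambda>p. duhamel_integrand F (fst p) (snd p)) \<in> borel_measurable ((borel \<Otimes>\<^sub>M borel) \<Otimes>\<^sub>M lborel)"
    using measurable_duhamel_integrand[OF assms]
    by (simp add: split_beta' measurable_cong_sets[OF sets_pair_measure_cong[OF refl sets_lborel] refl])
  from lborel.borel_measurable_lebesgue_integral[OF this]
  show ?thesis unfolding duhamel_def by (simp add: split_beta')
qed

text \<open>The constant \<open>D\<close> is separate from the uniform \<open>C\<close>: the
  supersolution estimate uses a bound that depends on \<open>\<tau>\<close>.\<close>

lemma green_bessel_bounds:
  fixes F :: "real \<Rightarrow> real^'n \<Rightarrow> real"
  assumes "0 \<le> a" "forcing a C T F" "0 \<le> \<tau>" "\<tau> \<le> T" "\<And>y. F \<tau> y \<le> D * weight a y" "0 \<le> r"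
  shows "0 \<le> green_op r (bessel_op (F \<tau>)) x"
    "green_op r (bessel_op (F \<tau>)) x \<le> exp (bessel_const TYPE('n) a * r) * (bessel_const TYPE('n) a * D) * weight a x"
proof -
  note dom = bessel_op_dominated[OF assms(1) forcing_dominated[OF assms(2-5)]]
  show "0 \<le> green_op r (bessel_op (F \<tau>)) x"
    by (intro green_op_nonneg[OF assms(1) dom assms(6)] bessel_op_nonneg forcingD(2)[OF assms(2-4)])
  show "green_op r (bessel_op (F \<tau>)) x \<le> exp (bessel_const TYPE('n) a * r) * (bessel_const TYPE('n) a * D) * weight a x"
    using green_op_abs_le[OF assms(1) dom assms(6), of x] by linarith
qed

lemma duhamel_integrand_bounds:
  fixes F :: "real \<Rightarrow> real^'n \<Rightarrow> real" and a :: real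
  defines "K \<equiv> bessel_const TYPE('n) a"
  assumes "0 \<le> a" "forcing a C T F" "t \<le> T"
  shows "0 \<le> duhamel_integrand F t x \<tau>"
    "duhamel_integrand F t x \<tau> \<le> indicator {0..t} \<tau> * (exp (K * T) * (K * C) * weight a x)"
proof -
  have "0 \<le> duhamel_integrand F t x \<tau> \<and>
     duhamel_integrand F t x \<tau> \<le> indicator {0..t} \<tau> * (exp (K * T) * (K * C) * weight a x)"
  proof (cases "\<tau> \<in> {0..t}")
    case True
    then have \<tau>: "0 \<le> \<tau>" "\<tau> \<le> T" "0 \<le> t - \<tau>" using assms by auto
    have K: "1 \<le> K" unfolding K_def by (rule bessel_const_ge_1)
    have C: "0 \<le> C" using dominated_const_nonneg[OF forcingD(1)[OF assms(3) \<tau>(1,2)]] .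
    have le: "F \<tau> y \<le> C * weight a y" for y using assms(3) \<tau> by (simp add: forcing_def)
    have "exp (K * (t - \<tau>)) * (K * C) * weight a x \<le> exp (K * T) * (K * C) * weight a x"
      using K C \<tau> assms by (intro mult_right_mono) (auto simp: weight_nonneg)
    then show ?thesis
      using green_bessel_bounds[OF assms(2,3) \<tau>(1,2) le \<tau>(3), of x] True
      unfolding duhamel_integrand_def K_def by auto
  qed (simp add: duhamel_integrand_def)
  then show "0 \<le> duhamel_integrand F t x \<tau>"
    "duhamel_integrand F t x \<tau> \<le> indicator {0..t} \<tau> * (exp (K * T) * (K * C) * weight a x)"
    by auto
qed

lemma integrable_Icc_const: "integrable lborel (\<lambda>\<tau>. indicator {s..t :: real} \<tau> * (D :: real))"
  by (intro integrable_mult_left integrable_real_indicator) (auto simp: emeasure_lborel_Icc_eq)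

lemma integrable_duhamel_integrand:
  fixes F :: "real \<Rightarrow> real^'n \<Rightarrow> real"
  assumes "0 \<le> a" "forcing a C T F" "t \<le> T"
  shows "integrable lborel (duhamel_integrand F t x)"
proof (rule Bochner_Integration.integrable_bound[OF integrable_Icc_const])
  show "duhamel_integrand F t x \<in> borel_measurable lborel"
    using assms measurable_duhamel_integrand_section by (auto simp: forcing_def)
  show "AE \<tau> in lborel. norm (duhamel_integrand F t x \<tau>) \<le> norm (indicator {0..t} \<tau> *
     (exp (bessel_const TYPE('n) a * T) * (bessel_const TYPE('n) a * C) * weight a x))"
    using duhamel_integrand_bounds[OF assms, of x] by (intro AE_I2) (auto simp: abs_of_nonneg intro: order_trans[OF _ abs_ge_self])
qed

lemma duhamel_nonneg:
  assumes "0 \<le> a" "forcing a C T F" "t \<le> T"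
  shows "0 \<le> duhamel F t x"
  unfolding duhamel_def by (intro Bochner_Integration.integral_nonneg duhamel_integrand_bounds[OF assms])

lemma duhamel_mono:
  assumes "0 \<le> a" "forcing a C T F" "forcing a D T G" "t \<le> T"
    and "\<And>\<tau> y. 0 \<le> \<tau> \<Longrightarrow> \<tau> \<le> t \<Longrightarrow> F \<tau> y \<le> G \<tau> y"
  shows "duhamel F t x \<le> duhamel G t x"
  unfolding duhamel_def
proof (rule integral_mono)
  show "integrable lborel (duhamel_integrand F t x)" "integrable lborel (duhamel_integrand G t x)"
    by (rule integrable_duhamel_integrand[OF assms(1,2,4)] integrable_duhamel_integrand[OF assms(1,3,4)])+
  fix \<tau>
  show "duhamel_integrand F t x \<tau> \<le> duhamel_integrand G t x \<tau>"
  proof (cases "\<tau> \<in> {0..t}")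
    case True
    then have \<tau>: "0 \<le> \<tau>" "\<tau> \<le> T" "0 \<le> t - \<tau>" "\<tau> \<le> t" using assms by auto
    note domF = forcingD(1)[OF assms(2) \<tau>(1,2)] and domG = forcingD(1)[OF assms(3) \<tau>(1,2)]
    have "green_op (t - \<tau>) (bessel_op (F \<tau>)) x \<le> green_op (t - \<tau>) (bessel_op (G \<tau>)) x"
      by (rule green_op_mono[OF assms(1) bessel_op_dominated[OF assms(1) domF] bessel_op_dominated[OF assms(1) domG] \<tau>(3)],
          rule bessel_op_mono[OF assms(1) domF domG], rule assms(5)) (use \<tau> in auto)
    then show ?thesis using True by (simp add: duhamel_integrand_def)
  qed (simp add: duhamel_integrand_def)
qed

text \<open>Dominated convergence is used on three levels: in space for \<open>bessel_op\<close>,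
  over the Green series, and finally in \<open>\<tau>\<close> with a constant majorant on
  \<open>{0..t}\<close>.\<close>

lemma duhamel_tendsto:
  fixes F :: "nat \<Rightarrow> real \<Rightarrow> real^'n \<Rightarrow> real"
  assumes "0 \<le> a" "\<And>i. forcing a C T (F i)" "forcing a D T G" "t \<le> T"
    and lim: "\<And>\<tau> y. 0 \<le> \<tau> \<Longrightarrow> \<tau> \<le> t \<Longrightarrow> (\<lambda>i. F i \<tau> y) \<longlonglongrightarrow> G \<tau> y"
  shows "(\<lambda>i. duhamel (F i) t x) \<longlonglongrightarrow> duhamel G t x"
  unfolding duhamel_def
proof (rule integral_dominated_convergence[OF _ _ integrable_Icc_const])
  show "duhamel_integrand G t x \<in> borel_measurable lborel"
    using assms(3) measurable_duhamel_integrand_section by (auto simp: forcing_def)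
  show "duhamel_integrand (F i) t x \<in> borel_measurable lborel" for i
    using assms(2)[of i] measurable_duhamel_integrand_section by (auto simp: forcing_def)
  show "AE \<tau> in lborel. norm (duhamel_integrand (F i) t x \<tau>) \<le> indicator {0..t} \<tau> *
     (exp (bessel_const TYPE('n) a * T) * (bessel_const TYPE('n) a * C) * weight a x)" for i
    using duhamel_integrand_bounds[OF assms(1,2,4), of i x] by (intro AE_I2) (auto simp: abs_of_nonneg)
  show "AE \<tau> in lborel. (\<lambda>i. duhamel_integrand (F i) t x \<tau>) \<longlonglongrightarrow> duhamel_integrand G t x \<tau>"
  proof (intro AE_I2)
    fix \<tau>
    show "(\<lambda>i. duhamel_integrand (F i) t x \<tau>) \<longlonglongrightarrow> duhamel_integrand G t x \<tau>"
    proof (cases "\<tau> \<in> {0..t}")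
      case True
      then have \<tau>: "0 \<le> \<tau>" "\<tau> \<le> T" "0 \<le> t - \<tau>" "\<tau> \<le> t" using assms by auto
      note domF = forcingD(1)[OF assms(2) \<tau>(1,2)] and domG = forcingD(1)[OF assms(3) \<tau>(1,2)]
      have "(\<lambda>i. green_op (t - \<tau>) (bessel_op (F i \<tau>)) x) \<longlonglongrightarrow> green_op (t - \<tau>) (bessel_op (G \<tau>)) x"
        by (rule green_op_tendsto[OF assms(1) bessel_op_dominated[OF assms(1) domF] bessel_op_dominated[OF assms(1) domG] \<tau>(3)],
            rule bessel_op_tendsto[OF assms(1) domF domG], rule lim) (use \<tau> in auto)
      then show ?thesis using True by (simp add: duhamel_integrand_def)
    qed (simp add: duhamel_integrand_def)
  qed
qed

text \<open>The slices of \<open>F\<close> are only measurable in space. Continuity appears once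
  \<open>bessel_op\<close> is applied, survives \<open>green_op\<close>, and passes through the time
  integral by dominated convergence.\<close>

lemma continuous_on_duhamel:
  fixes F :: "real \<Rightarrow> real^'n \<Rightarrow> real"
  assumes "0 \<le> a" "forcing a C T F" "0 \<le> t" "t \<le> T"
  shows "continuous_on UNIV (duhamel F t)"
  unfolding continuous_on_sequentially o_def
proof (intro ballI allI impI, elim conjE)
  fix X x assume X: "X \<longlonglongrightarrow> (x :: real^'n)"
  define D where "D = exp (bessel_const TYPE('n) a * T) * (bessel_const TYPE('n) a * C)"
  have "0 \<le> C" using dominated_const_nonneg[OF forcingD(1)[OF assms(2), of 0]] assms by simp
  then have D: "0 \<le> D" using bessel_const_ge_1[of "TYPE('n)" a] by (simp add: D_def)
  obtain W where W: "\<And>i. weight a (X i) \<le> W" using weight_convergent_bounded[OF X] by blast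
  show "(\<lambda>i. duhamel F t (X i)) \<longlonglongrightarrow> duhamel F t x"
    unfolding duhamel_def
  proof (rule integral_dominated_convergence[OF _ _ integrable_Icc_const])
    show "duhamel_integrand F t x \<in> borel_measurable lborel" "duhamel_integrand F t (X i) \<in> borel_measurable lborel" for i
      using assms measurable_duhamel_integrand_section by (auto simp: forcing_def)
    show "AE \<tau> in lborel. norm (duhamel_integrand F t (X i) \<tau>) \<le> indicator {0..t} \<tau> * (D * W)" for i
    proof (intro AE_I2)
      fix \<tau>
      have "duhamel_integrand F t (X i) \<tau> \<le> indicator {0..t} \<tau> * (D * weight a (X i))"
        using duhamel_integrand_bounds(2)[OF assms(1,2,4)] by (simp add: D_def)
      also have "\<dots> \<le> indicator {0..t} \<tau> * (D * W)"
        using D W by (intro mult_left_mono) auto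
      finally show "norm (duhamel_integrand F t (X i) \<tau>) \<le> indicator {0..t} \<tau> * (D * W)"
        using duhamel_integrand_bounds(1)[OF assms(1,2,4)] by (simp add: abs_of_nonneg)
    qed
    show "AE \<tau> in lborel. (\<lambda>i. duhamel_integrand F t (X i) \<tau>) \<longlonglongrightarrow> duhamel_integrand F t x \<tau>"
    proof (intro AE_I2)
      fix \<tau>
      show "(\<lambda>i. duhamel_integrand F t (X i) \<tau>) \<longlonglongrightarrow> duhamel_integrand F t x \<tau>"
      proof (cases "\<tau> \<in> {0..t}")
        case True
        then have \<tau>: "0 \<le> \<tau>" "\<tau> \<le> T" "0 \<le> t - \<tau>" "\<tau> \<le> t" using assms by auto
        note domF = forcingD(1)[OF assms(2) \<tau>(1,2)]
        have "(\<lambda>i. green_op (t - \<tau>) (bessel_op (F \<tau>)) (X i)) \<longlonglongrightarrow> green_op (t - \<tau>) (bessel_op (F \<tau>)) x"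
          by (rule continuous_on_tendsto_compose[OF continuous_on_green_op[OF assms(1)
                bessel_op_dominated[OF assms(1) domF] \<tau>(3) continuous_on_bessel_op[OF assms(1) domF]] X]) auto
        then show ?thesis using True by (simp add: duhamel_integrand_def)
      qed (simp add: duhamel_integrand_def)
    qed
  qed
qed

lemma duhamel_lipschitz:
  fixes F :: "real \<Rightarrow> real^'n \<Rightarrow> real" and a :: real
  defines "K \<equiv> bessel_const TYPE('n) a"
  assumes "0 \<le> a" "forcing a C T F" "0 \<le> s" "s \<le> t" "t \<le> T"
  shows "\<bar>duhamel F t x - duhamel F s x\<bar> \<le> exp (K * T) * (K * C) * ((K + 1) * T + 1) * weight a x * (t - s)"
proof -
  define D where "D = exp (K * T) * (K * C) * weight a x"
  have K: "1 \<le> K" unfolding K_def by (rule bessel_const_ge_1)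
  have C: "0 \<le> C" using dominated_const_nonneg[OF forcingD(1)[OF assms(3), of 0]] assms by simp
  have D: "0 \<le> D" using K C by (simp add: D_def weight_nonneg)
  have int: "integrable lborel (duhamel_integrand F t x)" "integrable lborel (duhamel_integrand F s x)"
    using integrable_duhamel_integrand[OF assms(2,3)] assms by auto
  have "duhamel F t x - duhamel F s x = (LINT \<tau>|lborel. duhamel_integrand F t x \<tau> - duhamel_integrand F s x \<tau>)"
    unfolding duhamel_def by (intro Bochner_Integration.integral_diff[symmetric] int)
  also have "\<bar>\<dots>\<bar> \<le> (LINT \<tau>|lborel. \<bar>duhamel_integrand F t x \<tau> - duhamel_integrand F s x \<tau>\<bar>)"
    by (rule integral_abs_bound)
  \<comment> \<open>Up to time \<open>s\<close> the Lipschitz bound for \<open>green_op\<close>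
    applies; between \<open>s\<close> and \<open>t\<close> only the later integrand remains and its
    size is used. Enlarging the first interval to \<open>{0..T}\<close> keeps the constant
    independent of \<open>s\<close> and \<open>t\<close>.\<close>
  also have "\<dots> \<le> (LINT \<tau>|lborel. indicator {0..T} \<tau> * ((K + 1) * D * (t - s)) + indicator {s..t} \<tau> * D)"
  proof (rule integral_mono)
    show "integrable lborel (\<lambda>\<tau>. \<bar>duhamel_integrand F t x \<tau> - duhamel_integrand F s x \<tau>\<bar>)"
      by (intro integrable_abs Bochner_Integration.integrable_diff int)
    show "integrable lborel (\<lambda>\<tau>. indicator {0..T} \<tau> * ((K + 1) * D * (t - s)) + indicator {s..t} \<tau> * D)"
      by (intro Bochner_Integration.integrable_add integrable_Icc_const)
    fix \<tau>
    have nn: "0 \<le> (K + 1) * D * (t - s)" using K D assms by simp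
    show "\<bar>duhamel_integrand F t x \<tau> - duhamel_integrand F s x \<tau>\<bar>
      \<le> indicator {0..T} \<tau> * ((K + 1) * D * (t - s)) + indicator {s..t} \<tau> * D"
    proof (cases "\<tau> \<in> {0..s}")
      case True
      then have \<tau>: "0 \<le> \<tau>" "\<tau> \<le> T" "0 \<le> s - \<tau>" "s - \<tau> \<le> t - \<tau>" "t - \<tau> \<le> T" using assms by auto
      note domF = forcingD(1)[OF assms(3) \<tau>(1,2)]
      have "\<bar>green_op (t - \<tau>) (bessel_op (F \<tau>)) x - green_op (s - \<tau>) (bessel_op (F \<tau>)) x\<bar>
          \<le> (K + 1) * exp (K * T) * (K * C) * weight a x * ((t - \<tau>) - (s - \<tau>))"
        unfolding K_def
        by (rule green_op_lipschitz[OF assms(2) bessel_op_dominated[OF assms(2) domF] bessel_op_nonneg \<tau>(3-5)])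
           (rule forcingD(2)[OF assms(3) \<tau>(1,2)])
      also have "\<dots> = (K + 1) * D * (t - s)" by (simp add: D_def)
      finally have "\<bar>duhamel_integrand F t x \<tau> - duhamel_integrand F s x \<tau>\<bar> \<le> (K + 1) * D * (t - s)"
        using True assms by (simp add: duhamel_integrand_def)
      moreover have "0 \<le> indicator {s..t} \<tau> * D" using D by simp
      ultimately show ?thesis using True assms by auto
    next
      case False
      then have "duhamel_integrand F s x \<tau> = 0" by (simp add: duhamel_integrand_def)
      moreover have "0 \<le> duhamel_integrand F t x \<tau>" "duhamel_integrand F t x \<tau> \<le> indicator {0..t} \<tau> * D"
        using duhamel_integrand_bounds[OF assms(2,3), of t] assms by (auto simp: D_def K_def)
      moreover have "indicator {0..t} \<tau> * D = indicator {s..t} \<tau> * D"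
        using False assms by (auto simp: indicator_def)
      moreover have "0 \<le> indicator {0..T} \<tau> * ((K + 1) * D * (t - s))" using nn by simp
      ultimately show ?thesis by linarith
    qed
  qed
  also have "\<dots> = T * ((K + 1) * D * (t - s)) + (t - s) * D"
    using assms by (subst Bochner_Integration.integral_add[OF integrable_Icc_const integrable_Icc_const]) simp
  finally show ?thesis by (simp add: D_def algebra_simps)
qed

text \<open>The right-hand side makes \<open>M e\<^bsup>(K + K q) t\<^esup> weight a\<close> a supersolution: it solves
  \<open>h t = M e\<^bsup>K t\<^esup> + \<integral>\<^sub>0\<^sup>t e\<^bsup>K (t - \<tau>)\<^esup> K q h \<tau> d\<tau>\<close>.\<close>

lemma duhamel_le_exp:
  fixes F :: "real \<Rightarrow> real^'n \<Rightarrow> real" and a :: real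
  defines "K \<equiv> bessel_const TYPE('n) a"
  assumes "0 \<le> a" "forcing a C T F" "0 \<le> t" "t \<le> T" "0 \<le> q" "0 \<le> M"
    and F_le: "\<And>\<tau> y. 0 \<le> \<tau> \<Longrightarrow> \<tau> \<le> t \<Longrightarrow> F \<tau> y \<le> q * M * exp ((K + K * q) * \<tau>) * weight a y"
  shows "duhamel F t x \<le> M * (exp ((K + K * q) * t) - exp (K * t)) * weight a x"
proof -
  define D where "D = M * exp (K * t) * weight a x"
  have K: "1 \<le> K" unfolding K_def by (rule bessel_const_ge_1)
  \<comment> \<open>The product of \<open>exp (K * (t - \<tau>))\<close> and
    \<open>exp ((K + K * q) * \<tau>)\<close> is \<open>exp (K * t) * exp (K * q * \<tau>)\<close>.
    The first factor goes into \<open>D\<close>; the second, times \<open>K * q\<close>, is an exact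
    derivative.\<close>
  let ?g = "\<lambda>\<tau>. (K * q * exp (K * q * \<tau>)) * indicator {0..t} \<tau>"
  have deriv: "((\<lambda>\<tau>. exp (K * q * \<tau>)) has_real_derivative K * q * exp (K * q * \<tau>)) (at \<tau>)" for \<tau>
    by (auto intro!: derivative_eq_intros)
  have g: "has_bochner_integral lborel ?g (exp (K * q * t) - exp (K * q * 0))"
    using deriv assms K by (intro has_bochner_integral_FTC_Icc_nonneg) auto
  have "duhamel F t x \<le> (LINT \<tau>|lborel. D * ?g \<tau>)"
    unfolding duhamel_def
  proof (rule integral_mono)
    show "integrable lborel (duhamel_integrand F t x)"
      using integrable_duhamel_integrand[OF assms(2,3)] assms by auto
    show "integrable lborel (\<lambda>\<tau>. D * ?g \<tau>)"
      using g by (intro integrable_mult_right) (auto simp: has_bochner_integral_iff)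
    fix \<tau>
    show "duhamel_integrand F t x \<tau> \<le> D * ?g \<tau>"
    proof (cases "\<tau> \<in> {0..t}")
      case True
      then have \<tau>: "0 \<le> \<tau>" "\<tau> \<le> T" "0 \<le> t - \<tau>" "\<tau> \<le> t" using assms by auto
      have "green_op (t - \<tau>) (bessel_op (F \<tau>)) x
          \<le> exp (K * (t - \<tau>)) * (K * (q * M * exp ((K + K * q) * \<tau>))) * weight a x"
        unfolding K_def
        by (rule green_bessel_bounds(2)[OF assms(2,3) \<tau>(1,2) F_le[OF \<tau>(1,4), unfolded K_def] \<tau>(3)])
      also have "\<dots> = M * weight a x * (K * q) * (exp (K * (t - \<tau>)) * exp ((K + K * q) * \<tau>))"
        by simp
      also have "exp (K * (t - \<tau>)) * exp ((K + K * q) * \<tau>) = exp (K * t) * exp (K * q * \<tau>)"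
        by (simp add: algebra_simps flip: exp_add)
      finally show ?thesis using True by (simp add: duhamel_integrand_def D_def mult_ac)
    qed (simp add: duhamel_integrand_def)
  qed
  also have "\<dots> = D * (exp (K * q * t) - 1)"
    using g by (simp add: has_bochner_integral_iff)
  also have "\<dots> = M * (exp ((K + K * q) * t) - exp (K * t)) * weight a x"
    by (simp add: D_def algebra_simps exp_add)
  finally show ?thesis .
qed

section \<open>Weighted bounds, the space \<open>BC a\<close> and the sublinear source\<close>

lemma weight_mono:
  assumes "a \<le> b"
  shows "weight a x \<le> weight b x"
  unfolding weight_def using assms by (intro powr_mono) auto

lemma weight_ge_1: "0 \<le> a \<Longrightarrow> 1 \<le> weight a x"
  using weight_mono[of 0 a x] add_pos_nonneg[of 1 "(norm x)\<^sup>2"] by (simp add: weight_def)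

text \<open>Outside a ball the weight dominates \<open>norm x powr a\<close>; inside, compactness
  bounds \<open>\<phi>\<close> and the weight is at least 1.\<close>

lemma BC_imp_dominated:
  fixes \<phi> :: "real^'n \<Rightarrow> real"
  assumes "0 \<le> a" "\<phi> \<in> BC a"
  obtains C where "dominated a C \<phi>"
proof -
  obtain C R where cont: "continuous_on UNIV \<phi>"
    and bd: "\<And>x. R \<le> norm x \<Longrightarrow> \<bar>\<phi> x\<bar> \<le> C * norm x powr a"
    using assms(2) by (auto simp: BC_def)
  have "compact (\<phi> ` cball 0 R)"
    by (intro compact_continuous_image continuous_on_subset[OF cont]) auto
  then obtain D where D: "\<And>x. norm x \<le> R \<Longrightarrow> \<bar>\<phi> x\<bar> \<le> D"
    using compact_imp_bounded by (fastforce simp: bounded_iff)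
  have "\<bar>\<phi> x\<bar> \<le> max \<bar>C\<bar> \<bar>D\<bar> * weight a x" for x
  proof (cases "R \<le> norm x")
    case True
    have "norm x powr a = ((norm x)\<^sup>2) powr (a / 2)"
      by (simp add: powr_powr flip: powr_numeral)
    also have "\<dots> \<le> weight a x"
      unfolding weight_def using assms(1) by (intro powr_mono2) auto
    finally have "\<bar>C\<bar> * norm x powr a \<le> max \<bar>C\<bar> \<bar>D\<bar> * weight a x"
      by (intro mult_mono) auto
    moreover have "C * norm x powr a \<le> \<bar>C\<bar> * norm x powr a" by (intro mult_right_mono) auto
    ultimately show ?thesis using bd[OF True] by linarith
  next
    case False
    then have "\<bar>\<phi> x\<bar> \<le> \<bar>D\<bar> * 1" using D[of x] by simp
    also have "\<dots> \<le> max \<bar>C\<bar> \<bar>D\<bar> * weight a x"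
      by (intro mult_mono weight_ge_1 assms) auto
    finally show ?thesis .
  qed
  moreover have "\<phi> \<in> borel_measurable borel" by (rule borel_measurable_continuous_onI[OF cont])
  ultimately show ?thesis using that by (auto simp: dominated_def)
qed

lemma BC_I:
  fixes \<phi> :: "real^'n \<Rightarrow> real"
  assumes "0 \<le> a" "continuous_on UNIV \<phi>" "\<And>x. \<bar>\<phi> x\<bar> \<le> C * weight a x"
  shows "\<phi> \<in> BC a"
proof -
  have "0 \<le> C * weight a (0 :: real^'n)" by (rule order_trans[OF abs_ge_zero assms(3)])
  then have C: "0 \<le> C" using weight_pos[of a "0 :: real^'n"] by (simp add: zero_le_mult_iff)
  have "\<bar>\<phi> x\<bar> \<le> (C * 2 powr (a / 2)) * norm x powr a" if "1 \<le> norm x" for x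
  proof -
    have "1 \<le> (norm x)\<^sup>2" using that by simp
    then have "weight a x \<le> (2 * (norm x)\<^sup>2) powr (a / 2)"
      unfolding weight_def using assms(1) by (intro powr_mono2) auto
    also have "\<dots> = 2 powr (a / 2) * norm x powr a"
      by (simp add: powr_mult powr_powr flip: powr_numeral)
    finally have "C * weight a x \<le> C * (2 powr (a / 2) * norm x powr a)"
      using C by (intro mult_left_mono)
    then show ?thesis using assms(3)[of x] by simp
  qed
  then show ?thesis using assms(2) by (auto simp: BC_def)
qed

text \<open>The assumed bound makes the real-valued \<open>SUP\<close> a genuine supremum;
  nonnegativity is then read off at the origin.\<close>

lemma BC_norm_bounds:
  fixes \<phi> :: "real^'n \<Rightarrow> real"
  assumes "\<And>x. \<bar>\<phi> x\<bar> \<le> D * weight a x"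
  shows "0 \<le> BC_norm 1 a \<phi>" "BC_norm 1 a \<phi> \<le> D"
proof -
  have le: "(1\<^sup>2 + (norm x)\<^sup>2) powr (- a / 2) * \<bar>\<phi> x\<bar> \<le> D" for x :: "real^'n"
  proof -
    have "(1\<^sup>2 + (norm x)\<^sup>2) powr (- a / 2) = inverse (weight a x)"
      by (simp add: weight_def powr_minus)
    then show ?thesis
      using assms[of x] weight_pos[of a x] by (simp only: divide_inverse[symmetric] pos_divide_le_eq mult.commute)
  qed
  show "BC_norm 1 a \<phi> \<le> D"
    unfolding BC_norm_def by (intro cSUP_least le) auto
  have "(1\<^sup>2 + (norm (0 :: real^'n))\<^sup>2) powr (- a / 2) * \<bar>\<phi> 0\<bar> \<le> BC_norm 1 a \<phi>"
    unfolding BC_norm_def by (intro cSUP_upper bdd_aboveI2[where M = D] le) auto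
  then show "0 \<le> BC_norm 1 a \<phi>"
    by (rule order_trans[rotated]) simp
qed

text \<open>Sublinearity enters here: \<open>h powr p \<le> h\<close> for \<open>h \<ge> 1\<close>
  keeps the bound linear in \<open>h\<close>, so the comparison function solves a linear equation
  and cannot blow up. The exponent condition lets the weight \<open>s + a * p\<close> be absorbed
  into \<open>a\<close>.\<close>

lemma source_le:
  assumes p: "0 < p" "p < 1" and "s + a * p \<le> a" "0 \<le> q" "1 \<le> h"
    and v: "0 \<le> v" "v \<le> q * weight s x" and z: "0 \<le> z" "z \<le> h * weight a x"
  shows "v * z powr p \<le> q * h * weight a x"
proof -
  have "z powr p \<le> (h * weight a x) powr p" using p z by (intro powr_mono2) auto
  also have "\<dots> = h powr p * weight (a * p) x"
    using assms by (simp add: powr_mult powr_powr weight_def)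
  also have "\<dots> \<le> h * weight (a * p) x"
    using powr_mono[of p 1 h] assms by (intro mult_right_mono weight_nonneg) simp
  finally have "v * z powr p \<le> (q * weight s x) * (h * weight (a * p) x)"
    using assms by (intro mult_mono) (auto simp: weight_nonneg)
  also have "\<dots> = q * h * weight (s + a * p) x"
    by (simp add: weight_def powr_add add_divide_distrib)
  also have "\<dots> \<le> q * h * weight a x"
    using assms by (intro mult_left_mono weight_mono) auto
  finally show ?thesis .
qed

subsection \<open>Monotone iteration\<close>

text \<open>Here \<open>s\<close> plays the role of the positive part of \<open>\<sigma>\<close>,
  and \<open>Q T\<close> bounds the time factor of \<open>V\<close> up to \<open>T\<close>. Since
  \<open>M \<ge> 1\<close>, the amplitude of the supersolution never falls below 1, as
  \<open>source_le\<close> requires.\<close>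

locale sublinear_problem =
  fixes V :: "real^'n \<Rightarrow> real \<Rightarrow> real" and Q :: "real \<Rightarrow> real" and p s a M K :: real
    and u0 :: "real^'n \<Rightarrow> real"
  assumes p: "0 < p" "p < 1" and a: "0 \<le> a" and s: "s + a * p \<le> a"
    and V_cont: "continuous_on (UNIV \<times> {0..}) (\<lambda>(x, t). V x t)"
    and V_nonneg: "\<And>x t. 0 \<le> t \<Longrightarrow> 0 \<le> V x t"
    and V_bound: "\<And>T t x. 0 \<le> t \<Longrightarrow> t \<le> T \<Longrightarrow> V x t \<le> Q T * weight s x"
    and Q: "\<And>T. 0 \<le> Q T"
    and u0_cont: "continuous_on UNIV u0" and u0_dom: "dominated a M u0"
    and u0_nonneg: "\<And>x. 0 \<le> u0 x" and M: "1 \<le> M"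
    and K: "K = bessel_const TYPE('n) a"
begin

text \<open>The rate of the supersolution up to time \<open>T\<close>: \<open>K\<close> stems from
  \<open>green_op\<close>, \<open>K * Q T\<close> from the source.\<close>

definition growth :: "real \<Rightarrow> real" where
  "growth T = K + K * Q T"

text \<open>The truncation \<open>max 0 \<tau>\<close> only serves joint measurability on all of \<open>\<real>\<close>:
  nothing is assumed about \<open>V\<close> at negative times.\<close>

definition source :: "(real \<Rightarrow> real^'n \<Rightarrow> real) \<Rightarrow> real \<Rightarrow> real^'n \<Rightarrow> real" where
  "source u \<tau> y = V y (max 0 \<tau>) * u \<tau> y powr p"

definition step :: "(real \<Rightarrow> real^'n \<Rightarrow> real) \<Rightarrow> real \<Rightarrow> real^'n \<Rightarrow> real" where
  "step u t x = green_op (max 0 t) u0 x + duhamel (source u) t x"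

definition iterate :: "nat \<Rightarrow> real \<Rightarrow> real^'n \<Rightarrow> real" where
  "iterate k = (step ^^ k) (\<lambda>t x. 0)"

definition solution :: "real \<Rightarrow> real^'n \<Rightarrow> real" where
  "solution t x = lim (\<lambda>k. iterate k t x)"

text \<open>The order interval between 0 and the supersolution. The bound is demanded for every
  horizon \<open>T \<ge> t\<close>, since \<open>Q\<close> is not assumed monotone; an estimate can
  then fix its horizon first.\<close>

definition admissible :: "(real \<Rightarrow> real^'n \<Rightarrow> real) \<Rightarrow> bool" where
  "admissible u \<longleftrightarrow> (\<lambda>(t, x). u t x) \<in> borel_measurable (borel \<Otimes>\<^sub>M borel) \<and>
     (\<forall>T t x. 0 \<le> t \<and> t \<le> T \<longrightarrow> 0 \<le> u t x \<and> u t x \<le> M * exp (growth T * t) * weight a x)"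

section \<open>Invariance of the order interval and convergence of the iterates\<close>

lemma K_ge_1: "1 \<le> K"
  unfolding K by (rule bessel_const_ge_1)

lemma growth_nonneg: "0 \<le> growth T"
  using K_ge_1 Q[of T] by (simp add: growth_def)

lemma measurable_V: "(\<lambda>(\<tau>, y). V y (max 0 \<tau>)) \<in> borel_measurable (borel \<Otimes>\<^sub>M borel)"
proof -
  have "continuous_on UNIV (\<lambda>q :: real \<times> (real^'n). (\<lambda>(x, t). V x t) (snd q, max 0 (fst q)))"
    by (rule continuous_on_compose2[OF V_cont]) (auto intro!: continuous_intros)
  then show ?thesis
    unfolding borel_prod split_beta' by (intro borel_measurable_continuous_onI) simp
qed

lemma source_bounds:
  assumes "admissible u" "0 \<le> \<tau>" "\<tau> \<le> T"
  shows "0 \<le> source u \<tau> y" "source u \<tau> y \<le> Q T * M * exp (growth T * \<tau>) * weight a y"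
proof -
  have u: "0 \<le> u \<tau> y" "u \<tau> y \<le> M * exp (growth T * \<tau>) * weight a y"
    using assms by (auto simp: admissible_def)
  have "1 * 1 \<le> M * exp (growth T * \<tau>)"
    using M growth_nonneg assms by (intro mult_mono) auto
  then have h: "1 \<le> M * exp (growth T * \<tau>)" by simp
  show "0 \<le> source u \<tau> y" unfolding source_def using V_nonneg by simp
  have "V y (max 0 \<tau>) * u \<tau> y powr p \<le> Q T * (M * exp (growth T * \<tau>)) * weight a y"
    using assms by (intro source_le[OF p s Q h _ _ u] V_nonneg V_bound) auto
  then show "source u \<tau> y \<le> Q T * M * exp (growth T * \<tau>) * weight a y"
    by (simp add: source_def mult.assoc)
qed

lemma source_forcing:
  assumes "admissible u"
  shows "forcing a (Q T * M * exp (growth T * T)) T (source u)"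
proof -
  have [measurable]: "(\<lambda>(t, x). u t x) \<in> borel_measurable (borel \<Otimes>\<^sub>M borel)"
    using assms by (simp add: admissible_def)
  note [measurable] = measurable_V
  have "(\<lambda>(\<tau>, y). source u \<tau> y) \<in> borel_measurable (borel \<Otimes>\<^sub>M borel)"
    unfolding source_def by measurable
  moreover have "source u \<tau> y \<le> Q T * M * exp (growth T * T) * weight a y" if "\<tau> \<in> {0..T}" for \<tau> y
  proof -
    have "source u \<tau> y \<le> Q T * M * exp (growth T * \<tau>) * weight a y"
      using source_bounds[OF assms] that by auto
    also have "\<dots> \<le> Q T * M * exp (growth T * T) * weight a y"
      using that growth_nonneg Q M by (intro mult_right_mono mult_left_mono) (auto simp: weight_nonneg mult_left_mono)
    finally show ?thesis .
  qed
  ultimately show ?thesis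
    unfolding forcing_def using source_bounds(1)[OF assms] by auto
qed

lemma step_admissible:
  assumes "admissible u"
  shows "admissible (step u)"
  unfolding admissible_def
proof (intro conjI allI impI)
  have u0: "(\<lambda>(m :: real, x). u0 x) \<in> borel_measurable (borel \<Otimes>\<^sub>M borel)"
    using dominatedD(1)[OF u0_dom] by simp
  have r: "(\<lambda>m :: real. max 0 m) \<in> borel_measurable borel" by simp
  have F: "(\<lambda>(\<tau>, y). source u \<tau> y) \<in> borel_measurable (borel \<Otimes>\<^sub>M borel)"
    using source_forcing[OF assms] by (simp add: forcing_def)
  show "(\<lambda>(t, x). step u t x) \<in> borel_measurable (borel \<Otimes>\<^sub>M borel)"
    using borel_measurable_add[OF measurable_green_op_param[OF u0 r] measurable_duhamel[OF F]]
    by (simp add: step_def split_beta')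
next
  fix T t :: real and x :: "real^'n" assume "0 \<le> t \<and> t \<le> T"
  then have t: "0 \<le> t" "t \<le> T" by auto
  show "0 \<le> step u t x"
    unfolding step_def using t
    by (intro add_nonneg_nonneg green_op_nonneg[OF a u0_dom] duhamel_nonneg[OF a source_forcing[OF assms]] u0_nonneg) auto
  \<comment> \<open>The initial datum contributes \<open>M * exp (K * t)\<close>, which cancels the
    subtracted term in the Duhamel bound, so the sum is exactly the supersolution.\<close>
  have "green_op t u0 x \<le> exp (K * t) * M * weight a x"
    using green_op_abs_le[OF a u0_dom t(1), of x, folded K] by linarith
  moreover have "duhamel (source u) t x \<le> M * (exp ((K + K * Q T) * t) - exp (K * t)) * weight a x"
    using M t source_bounds(2)[OF assms, of _ T]
    by (intro duhamel_le_exp[OF a source_forcing[OF assms] t Q, folded K]) (auto simp: growth_def)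
  ultimately show "step u t x \<le> M * exp (growth T * t) * weight a x"
    using t by (simp add: step_def growth_def algebra_simps)
qed

lemma iterate_admissible: "admissible (iterate k)"
proof (induction k)
  case 0
  show ?case using M by (auto simp: iterate_def admissible_def weight_nonneg)
next
  case (Suc k)
  then show ?case using step_admissible by (simp add: iterate_def)
qed

text \<open>The first iterate is nonnegative and hence above the zero start; then monotonicity of
  \<open>z powr p\<close> on nonnegative \<open>z\<close> and of \<open>duhamel\<close> propagates
  the order.\<close>

lemma iterate_mono:
  assumes "0 \<le> t"
  shows "iterate k t x \<le> iterate (Suc k) t x"
  using assms
proof (induction k arbitrary: t x)
  case 0
  then show ?case
    using iterate_admissible[of 1] by (auto simp: iterate_def admissible_def)
next
  case (Suc k)
  have "duhamel (source (iterate k)) t x \<le> duhamel (source (iterate (Suc k))) t x"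
  proof (rule duhamel_mono[OF a source_forcing[OF iterate_admissible] source_forcing[OF iterate_admissible] order_refl])
    fix \<tau> y assume "0 \<le> \<tau>" "\<tau> \<le> t"
    then show "source (iterate k) \<tau> y \<le> source (iterate (Suc k)) \<tau> y"
      unfolding source_def using p Suc.IH[of \<tau> y] iterate_admissible[of k]
      by (intro mult_left_mono powr_mono2 V_nonneg) (auto simp: admissible_def)
  qed
  then show ?case by (simp add: iterate_def step_def)
qed

lemma iterate_tendsto:
  assumes "0 \<le> t"
  shows "(\<lambda>k. iterate k t x) \<longlonglongrightarrow> solution t x"
proof -
  have "incseq (\<lambda>k. iterate k t x)" using iterate_mono[OF assms] by (intro incseq_SucI)
  moreover have "iterate k t x \<le> M * exp (growth t * t) * weight a x" for k
    using iterate_admissible[of k] assms by (auto simp: admissible_def)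
  ultimately obtain l where "(\<lambda>k. iterate k t x) \<longlonglongrightarrow> l"
    using incseq_convergent by metis
  then show ?thesis unfolding solution_def by (simp add: limI)
qed

lemma solution_admissible: "admissible solution"
  unfolding admissible_def
proof (intro conjI allI impI)
  have "(\<lambda>q. iterate k (fst q) (snd q)) \<in> borel_measurable (borel \<Otimes>\<^sub>M borel)" for k
    using iterate_admissible[of k] by (simp add: admissible_def split_beta')
  \<comment> \<open>Measurability of \<open>lim\<close> does not presuppose convergence, so negative
    times need no separate treatment.\<close>
  then show "(\<lambda>(t, x). solution t x) \<in> borel_measurable (borel \<Otimes>\<^sub>M borel)"
    unfolding solution_def split_beta' by (rule borel_measurable_lim_metric)
next
  fix T t :: real and x :: "real^'n" assume t: "0 \<le> t \<and> t \<le> T"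
  show "0 \<le> solution t x"
    by (rule LIMSEQ_le_const[OF iterate_tendsto]) (use t iterate_admissible in \<open>auto simp: admissible_def\<close>)
  show "solution t x \<le> M * exp (growth T * t) * weight a x"
    by (rule LIMSEQ_le_const2[OF iterate_tendsto]) (use t iterate_admissible in \<open>auto simp: admissible_def\<close>)
qed

text \<open>Passage to the limit in \<open>iterate (Suc k) = step (iterate k)\<close>. Since
  \<open>p > 0\<close>, the power is continuous on the closed half-line, including at 0, where it
  fails to be Lipschitz.\<close>

lemma solution_eq:
  assumes t: "0 \<le> t"
  shows "solution t x = green_op t u0 x + duhamel (source solution) t x"
proof -
  have "(\<lambda>k. duhamel (source (iterate k)) t x) \<longlonglongrightarrow> duhamel (source solution) t x"
  proof (rule duhamel_tendsto[OF a source_forcing[OF iterate_admissible] source_forcing[OF solution_admissible] order_refl])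
    fix \<tau> y assume "0 \<le> \<tau>" "\<tau> \<le> t"
    then show "(\<lambda>k. source (iterate k) \<tau> y) \<longlonglongrightarrow> source solution \<tau> y"
      unfolding source_def using p iterate_admissible
      by (intro tendsto_intros tendsto_powr' iterate_tendsto) (auto simp: admissible_def)
  qed
  then have "(\<lambda>k. iterate (Suc k) t x) \<longlonglongrightarrow> green_op t u0 x + duhamel (source solution) t x"
    using t by (simp add: iterate_def step_def tendsto_intros)
  moreover have "(\<lambda>k. iterate (Suc k) t x) \<longlonglongrightarrow> solution t x"
    using iterate_tendsto[OF t] by (rule LIMSEQ_Suc)
  ultimately show ?thesis by (rule LIMSEQ_unique[rotated])
qed

text \<open>Continuity is inherited from the right-hand side of the fixed-point equation, not from
  the monotone limit.\<close>

lemma solution_BC: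
  assumes t: "0 \<le> t"
  shows "solution t \<in> BC a"
proof (rule BC_I[OF a])
  have "continuous_on UNIV (\<lambda>x. green_op t u0 x + duhamel (source solution) t x)"
    by (intro continuous_on_add continuous_on_green_op[OF a u0_dom t u0_cont]
        continuous_on_duhamel[OF a source_forcing[OF solution_admissible] t order_refl])
  then show "continuous_on UNIV (solution t)" by (simp add: solution_eq[OF t, abs_def])
  show "\<bar>solution t x\<bar> \<le> M * exp (growth t * t) * weight a x" for x
    using solution_admissible t unfolding admissible_def by (metis abs_of_nonneg order_refl)
qed

text \<open>The two summands of \<open>D\<close> belong to \<open>green_op\<close> applied to
  \<open>u0\<close> and to the Duhamel term; both carry the factor \<open>weight a x\<close>, so the
  estimate is one in \<open>BC_norm\<close>.\<close>

lemma solution_lipschitz: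
  obtains D where "\<And>t t' x. 0 \<le> t \<Longrightarrow> t \<le> T \<Longrightarrow> 0 \<le> t' \<Longrightarrow> t' \<le> T \<Longrightarrow>
    \<bar>solution t' x - solution t x\<bar> \<le> D * \<bar>t' - t\<bar> * weight a x"
proof -
  define C where "C = Q T * M * exp (growth T * T)"
  define D where "D = (K + 1) * exp (K * T) * M + exp (K * T) * (K * C) * ((K + 1) * T + 1)"
  have D: "\<bar>solution t' x - solution t x\<bar> \<le> D * (t' - t) * weight a x"
    if "0 \<le> t" "t \<le> t'" "t' \<le> T" for t t' x
  proof -
    have "\<bar>green_op t' u0 x - green_op t u0 x\<bar> \<le> (K + 1) * exp (K * T) * M * weight a x * (t' - t)"
      by (rule green_op_lipschitz[OF a u0_dom u0_nonneg that, folded K])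
    moreover have "\<bar>duhamel (source solution) t' x - duhamel (source solution) t x\<bar>
       \<le> exp (K * T) * (K * C) * ((K + 1) * T + 1) * weight a x * (t' - t)"
      unfolding C_def by (rule duhamel_lipschitz[OF a source_forcing[OF solution_admissible] that, folded K])
    moreover have "D * (t' - t) * weight a x = (K + 1) * exp (K * T) * M * weight a x * (t' - t)
       + exp (K * T) * (K * C) * ((K + 1) * T + 1) * weight a x * (t' - t)"
      unfolding D_def by algebra
    ultimately show ?thesis
      using that by (simp only: solution_eq order_trans[OF that(1,2)])
  qed
  show ?thesis
  proof (rule that)
    fix t t' x assume "0 \<le> t" "t \<le> T" "0 \<le> t'" "t' \<le> T"
    then show "\<bar>solution t' x - solution t x\<bar> \<le> D * \<bar>t' - t\<bar> * weight a x"
      using D[of t t' x] D[of t' t x] by (cases "t \<le> t'") (auto simp: abs_minus_commute)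
  qed
qed

lemma solution_Z: "solution \<in> Z_space \<infinity> a"
  unfolding Z_space_def
proof (intro CollectI conjI allI impI)
  fix t :: real assume "0 \<le> t \<and> ereal t < \<infinity>"
  then show "solution t \<in> BC a" by (simp add: solution_BC)
next
  fix t0 :: real assume t0: "0 \<le> t0 \<and> ereal t0 < \<infinity>"
  \<comment> \<open>The horizon \<open>t0 + 1\<close> leaves room to the right of \<open>t0\<close>,
    so one Lipschitz constant serves a whole relative neighbourhood.\<close>
  obtain D where D: "\<And>t t' x. 0 \<le> t \<Longrightarrow> t \<le> t0 + 1 \<Longrightarrow> 0 \<le> t' \<Longrightarrow> t' \<le> t0 + 1 \<Longrightarrow>
    \<bar>solution t' x - solution t x\<bar> \<le> D * \<bar>t' - t\<bar> * weight a x"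
    by (rule solution_lipschitz[of "t0 + 1"]) blast
  have "\<forall>\<^sub>F t in at t0 within {t. 0 \<le> t \<and> ereal t < \<infinity>}. 0 \<le> t \<and> t < t0 + 1"
  proof -
    have "\<forall>\<^sub>F t in at t0 within {t. 0 \<le> t \<and> ereal t < \<infinity>}. t < t0 + 1"
      by (rule order_tendstoD[OF tendsto_ident_at]) simp
    moreover have "\<forall>\<^sub>F t in at t0 within {t. 0 \<le> t \<and> ereal t < \<infinity>}. t \<in> {t. 0 \<le> t \<and> ereal t < \<infinity>}"
      by (simp add: eventually_at_filter)
    ultimately show ?thesis by eventually_elim simp
  qed
  then have "\<forall>\<^sub>F t in at t0 within {t. 0 \<le> t \<and> ereal t < \<infinity>}.
      norm (BC_norm 1 a (\<lambda>x. solution t x - solution t0 x)) \<le> D * \<bar>t - t0\<bar>"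
  proof eventually_elim
    case (elim t)
    then have "\<bar>solution t x - solution t0 x\<bar> \<le> D * \<bar>t - t0\<bar> * weight a x" for x
      using D[of t0 t x] t0 by simp
    from BC_norm_bounds[OF this] show ?case by simp
  qed
  moreover have "((\<lambda>t. D * \<bar>t - t0\<bar>) \<longlongrightarrow> 0) (at t0 within {t. 0 \<le> t \<and> ereal t < \<infinity>})"
    by (auto intro!: tendsto_eq_intros)
  ultimately show "((\<lambda>t. BC_norm 1 a (\<lambda>x. solution t x - solution t0 x)) \<longlongrightarrow> 0)
      (at t0 within {t. 0 \<le> t \<and> ereal t < \<infinity>})"
    by (rule Lim_null_comparison)
qed

lemma mild_solution_solution: "mild_solution V p a u0 \<infinity> solution"
  unfolding mild_solution_def
proof (intro conjI allI impI solution_Z)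
  fix t :: real and x :: "real^'n" assume "0 \<le> t \<and> ereal t < \<infinity>"
  then have t: "0 \<le> t" by simp
  show "0 \<le> solution t x" using solution_admissible t by (auto simp: admissible_def)
  have "duhamel (source solution) t x
     = (LINT \<tau>:{0..t}|lborel. green_op (t - \<tau>) (bessel_op (\<lambda>y. V y \<tau> * solution \<tau> y powr p)) x)"
    \<comment> \<open>On \<open>{0..t}\<close> the truncation \<open>max 0 \<tau>\<close> equals
      \<open>\<tau>\<close>, so \<open>source\<close> is the original nonlinearity.\<close>
    unfolding duhamel_set_integral by (intro set_lebesgue_integral_cong) (auto simp: source_def[abs_def])
  then show "solution t x = green_op t u0 x +
      (LINT \<tau>:{0..t}|lborel. green_op (t - \<tau>) (bessel_op (\<lambda>y. V y \<tau> * solution \<tau> y powr p)) x)"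
    using solution_eq[OF t] by simp
qed

end

section \<open>Choice of the constants for the given data\<close>

theorem mainTheorem1:
  fixes V :: "real^'n \<Rightarrow> real \<Rightarrow> real"
    and Lam :: "real \<Rightarrow> real"
    and p theta sigma a :: real
    and u0 :: "real^'n \<Rightarrow> real"
  assumes p: "0 < p" "p < 1"
    and V_cont: "continuous_on (UNIV \<times> {0..}) (\<lambda>(x, t). V x t)"
    and V_nonneg: "\<And>x t. 0 \<le> t \<Longrightarrow> 0 \<le> V x t"
    and Lam_cont: "continuous_on {0..} Lam"
    and Lam_nonneg: "\<And>t. 0 \<le> t \<Longrightarrow> 0 \<le> Lam t"
    and theta: "0 < theta"
    and V_bound: "\<And>x t. 0 \<le> t \<Longrightarrow>
                    V x t \<le> theta * Lam t * (1 + (norm x)\<^sup>2) powr (pos_part sigma / 2)"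
    and a: "a \<ge> pos_part sigma / (1 - p)"
    and u0: "u0 \<in> BC a" "\<And>x. 0 \<le> u0 x"
  shows "\<exists>u. mild_solution V p a u0 \<infinity> u"
proof -
  have "0 \<le> pos_part sigma / (1 - p)" using p by (simp add: pos_part_def)
  then have a0: "0 \<le> a" using a by linarith
  \<comment> \<open>The hypothesis on \<open>a\<close>, multiplied by the positive number
    \<open>1 - p\<close>.\<close>
  have s: "pos_part sigma + a * p \<le> a"
    using a p by (simp add: pos_divide_le_eq algebra_simps)
  have "\<exists>q\<ge>0. \<forall>t. 0 \<le> t \<and> t \<le> T \<longrightarrow> Lam t \<le> q" for T
  proof -
    have "compact (Lam ` {0..T})"
      by (intro compact_continuous_image continuous_on_subset[OF Lam_cont]) auto
    then obtain L where L: "\<And>t. t \<in> {0..T} \<Longrightarrow> \<bar>Lam t\<bar> \<le> L"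
      using compact_imp_bounded by (fastforce simp: bounded_iff)
    show ?thesis
      \<comment> \<open>For negative \<open>T\<close> the interval is empty and \<open>L\<close> is
        arbitrary; the absolute value ensures nonnegativity in all cases.\<close>
      by (rule exI[of _ "\<bar>L\<bar>"]) (use L in fastforce)
  qed
  then obtain q where q: "\<And>T. 0 \<le> q T" "\<And>T t. 0 \<le> t \<Longrightarrow> t \<le> T \<Longrightarrow> Lam t \<le> q T"
    by metis
  obtain C where C: "dominated a C u0" using BC_imp_dominated[OF a0 u0(1)] .
  \<comment> \<open>The bound is raised to at least 1 to meet the condition \<open>M \<ge> 1\<close>
    of the locale.\<close>
  have dom: "dominated a (max 1 C) u0"
    unfolding dominated_def
  proof (intro conjI allI dominatedD(1)[OF C])
    fix x :: "real^'n"
    have "C * weight a x \<le> max 1 C * weight a x" by (intro mult_right_mono weight_nonneg) simp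
    then show "\<bar>u0 x\<bar> \<le> max 1 C * weight a x" using dominatedD(2)[OF C, of x] by linarith
  qed
  interpret sublinear_problem V "\<lambda>T. theta * q T" p "pos_part sigma" a "max 1 C" "bessel_const TYPE('n) a" u0
  proof
    show "continuous_on UNIV u0" using u0(1) by (simp add: BC_def)
    show "V x t \<le> theta * q T * weight (pos_part sigma) x" if "0 \<le> t" "t \<le> T" for T t x
    proof -
      have "theta * Lam t * weight (pos_part sigma) x \<le> theta * q T * weight (pos_part sigma) x"
        using theta q(2)[OF that] by (intro mult_right_mono mult_left_mono weight_nonneg) auto
      then show ?thesis using V_bound[OF that(1), of x] by (simp add: weight_def)
    qed
    show "0 \<le> theta * q T" for T using theta q by simp
  qed (use p a0 s V_cont V_nonneg dom u0(2) in auto)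
  show ?thesis using mild_solution_solution by blast
qed

end
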